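(* Let $H$ be a fixed (finite, simple) graph with chromatic number $\chi(H)=6$ that has a color-critical edge. Then there is an integer $N_H$ such that every finite point set $P\subset\mathbb{R}^2$ with $|P|\ge N_H$ contains four collinear points or has a copy of $H$ in its visibility graph $\mathcal{V}_P$.
   Context: For a finite point set $P\subset\mathbb{R}^2$, two distinct points $p,q\in P$ are visible in $P$ if the open line segment joining them contains no point of $P$. The visibility graph $\mathcal{V}_P$ has vertex set $P$, with two distinct vertices adjacent if and only if they are visible in $P$. A copy of a graph $H$ in a graph $G$ means a (not necessarily induced) subgraph of $G$ isomorphic to $H$. For a graph $H$ with $\chi(H)=6$, an edge $e\in E(H)$ is color-critical if $\chi(H\setminus e)=5$, where $H\setminus e$ is the graph obtained from $H$ by deleting the edge $e$ (keeping all vertices). *)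

theory Defs
  imports
    "HOL-Analysis.Analysis"
    "Graph_Theory.Pair_Digraph"
    "Graph_Theory.Digraph_Isomorphism"
begin

text \<open>
  A finite simple graph is a \<^locale>\<open>pair_graph\<close>: a finite, loop-free, symmetric digraph without
  parallel arcs, so that the undirected edge between \<open>u\<close> and \<open>v\<close> is the pair of arcs
  \<open>(u, v)\<close>, \<open>(v, u)\<close>.
\<close>

definition proper_coloring :: "'a pair_pre_digraph \<Rightarrow> nat \<Rightarrow> ('a \<Rightarrow> nat) \<Rightarrow> bool" where
  "proper_coloring G k c \<longleftrightarrow>
     c \<in> pverts G \<rightarrow> {..<k} \<and> (\<forall>(u, v) \<in> parcs G. c u \<noteq> c v)"

text \<open>The minimum below is attained for every \<^locale>\<open>pair_graph\<close> (see \<open>chromatic_number_coloring\<close>).\<close>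

definition chromatic_number :: "'a pair_pre_digraph \<Rightarrow> nat" where
  "chromatic_number G = (LEAST k. \<exists>c. proper_coloring G k c)"

text \<open>Deleting one undirected edge removes both of its arcs.\<close>

definition delete_edge :: "'a pair_pre_digraph \<Rightarrow> 'a \<times> 'a \<Rightarrow> 'a pair_pre_digraph" where
  "delete_edge G e = G\<lparr>parcs := parcs G - {e, (snd e, fst e)}\<rparr>"

text \<open>An edge whose deletion lowers the chromatic number by one (from 6 to 5 in particular).\<close>

definition color_critical :: "'a pair_pre_digraph \<Rightarrow> 'a \<times> 'a \<Rightarrow> bool" where
  "color_critical G e \<longleftrightarrow>
     e \<in> parcs G \<and> chromatic_number (delete_edge G e) + 1 = chromatic_number G"

definition contains_copy :: "'b pair_pre_digraph \<Rightarrow> 'a pair_pre_digraph \<Rightarrow> bool" where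
  "contains_copy G H \<longleftrightarrow>
     (\<exists>K :: 'b pair_pre_digraph. pair_graph K \<and>
        subgraph (with_proj K) (with_proj G) \<and> digraph_iso (with_proj H) (with_proj K))"

definition visible :: "(real^2) set \<Rightarrow> real^2 \<Rightarrow> real^2 \<Rightarrow> bool" where
  "visible P p q \<longleftrightarrow> p \<in> P \<and> q \<in> P \<and> p \<noteq> q \<and> open_segment p q \<inter> P = {}"

definition visibility_graph :: "(real^2) set \<Rightarrow> (real^2) pair_pre_digraph" where
  "visibility_graph P = \<lparr>pverts = P, parcs = {(p, q). visible P p q}\<rparr>"

definition has_four_collinear :: "(real^2) set \<Rightarrow> bool" where
  "has_four_collinear P \<longleftrightarrow> (\<exists>S \<subseteq> P. card S = 4 \<and> collinear S)"

lemma chromatic_number_coloring: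
  assumes "pair_graph G"
  shows "\<exists>c. proper_coloring G (chromatic_number G) c"
proof -
  interpret pair_graph G by fact
  obtain f where f: "bij_betw f (pverts G) {0..<card (pverts G)}"
    using ex_bij_betw_finite_nat[OF pair_finite_verts] by blast
  have "f u \<noteq> f v" if "(u, v) \<in> parcs G" for u v
    using that pair_no_loops[OF that] in_arcsD1[OF that] in_arcsD2[OF that] f
    by (auto simp: bij_betw_def inj_on_def)
  then have "proper_coloring G (card (pverts G)) f"
    using bij_betw_apply[OF f] by (auto simp: proper_coloring_def)
  then have "\<exists>c. proper_coloring G (card (pverts G)) c" by blast
  then show ?thesis
    unfolding chromatic_number_def by (rule LeastI[where P = "\<lambda>k. \<exists>c. proper_coloring G k c"])
qed

lemma pair_graph_delete_edge:
  assumes "pair_graph G"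
  shows "pair_graph (delete_edge G e)"
proof -
  interpret pair_graph G by fact
  have s: "(v, u) \<in> parcs G" if "(u, v) \<in> parcs G" for u v
    using that pair_sym_arcs by (auto simp: symmetric_def dest: symD)
  show ?thesis
    by unfold_locales
      (auto simp: delete_edge_def symmetric_def intro!: symI s
        dest: in_arcsD1 in_arcsD2 pair_no_loops)
qed

lemma pair_graph_visibility_graph:
  assumes "finite P"
  shows "pair_graph (visibility_graph P)"
proof -
  have "finite {(p, q). visible P p q}"
    by (rule finite_subset[of _ "P \<times> P"]) (use assms in \<open>auto simp: visible_def\<close>)
  then show ?thesis
    using assms
    by unfold_locales
      (auto simp: visibility_graph_def visible_def symmetric_def open_segment_commute intro!: symI)
qed

lemma contains_copy_iff:
  assumes H: "pair_graph H" and G: "pair_graph G"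
  shows "contains_copy G H \<longleftrightarrow>
    (\<exists>f. inj_on f (pverts H) \<and> f ` pverts H \<subseteq> pverts G \<and>
         (\<forall>(u, v) \<in> parcs H. (f u, f v) \<in> parcs G))"
  (is "?L \<longleftrightarrow> ?R")
proof
  assume ?L
  then obtain K m where sub: "subgraph (with_proj K) (with_proj G)"
    and iso: "pre_digraph.digraph_isomorphism (with_proj H) m"
    and K: "with_proj K = app_iso m (with_proj H)"
    unfolding contains_copy_def digraph_iso_def by blast
  have v: "pverts K = iso_verts m ` pverts H" and a: "parcs K = iso_arcs m ` parcs H"
    and t: "fst = iso_tail m" and h: "snd = iso_head m"
    using K by (simp_all add: with_proj_def app_iso_def)
  have sv: "pverts K \<subseteq> pverts G" and sa: "parcs K \<subseteq> parcs G"
    using sub by (auto simp: subgraph_def)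
  have inj: "inj_on (iso_verts m) (pverts H)"
    and e: "\<And>u v. (u, v) \<in> parcs H \<Longrightarrow> iso_arcs m (u, v) = (iso_verts m u, iso_verts m v)"
    using iso unfolding pre_digraph.digraph_isomorphism_def
    by (auto simp flip: t h simp: prod_eq_iff)
  have "(iso_verts m u, iso_verts m v) \<in> parcs G" if "(u, v) \<in> parcs H" for u v
    using e[OF that] that a sa by (metis image_eqI subsetD)
  then show ?R
    using inj sv v by (intro exI[of _ "iso_verts m"]) auto
next
  assume ?R
  then obtain f where inj: "inj_on f (pverts H)" and fv: "f ` pverts H \<subseteq> pverts G"
    and fa: "\<And>u v. (u, v) \<in> parcs H \<Longrightarrow> (f u, f v) \<in> parcs G"
    by fast
  interpret H: pair_graph H by fact
  interpret G: pair_graph G by fact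
  define K where "K = \<lparr>pverts = f ` pverts H, parcs = map_prod f f ` parcs H\<rparr>"
  define m where "m = \<lparr>iso_verts = f, iso_arcs = map_prod f f, iso_head = snd, iso_tail = fst\<rparr>"
  have s: "(v, u) \<in> parcs H" if "(u, v) \<in> parcs H" for u v
    using that H.pair_sym_arcs by (auto simp: symmetric_def dest: symD)
  have nl: "f u \<noteq> f v" if "(u, v) \<in> parcs H" for u v
    using fa[OF that] G.pair_no_loops by fastforce
  have K: "pair_graph K"
    by unfold_locales
      (auto simp: K_def symmetric_def H.pair_finite_verts H.pair_finite_arcs nl
        intro!: symI dest: H.in_arcsD1 H.in_arcsD2 s intro: rev_image_eqI)
  interpret K: pair_graph K by fact
  have "subgraph (with_proj K) (with_proj G)"
    using fv fa K.wf_digraph_axioms G.wf_digraph_axioms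
    by (auto simp: subgraph_def K_def compatible_def)
  moreover have "inj_on (map_prod f f) (parcs H)"
    by (rule inj_on_subset[OF map_prod_inj_on[OF inj inj]]) (auto dest: H.in_arcsD1 H.in_arcsD2)
  then have "pre_digraph.digraph_isomorphism (with_proj H) m"
    using inj H.wf_digraph_axioms
    by (auto simp: pre_digraph.digraph_isomorphism_def m_def)
  moreover have "with_proj K = app_iso m (with_proj H)"
    by (simp add: with_proj_def app_iso_def K_def m_def)
  ultimately show ?L
    unfolding contains_copy_def digraph_iso_def using K by blast
qed

end

theory Submission
  imports Defs
begin

text \<open>
  Assume that \<open>P\<close> has no four collinear points and let \<open>f(Q)\<close> be the number of collinear triples in
  \<open>Q \<subseteq> P\<close>. If \<open>Q\<close> is the intersection of \<open>P\<close> with a convex set, \<open>f(Q)\<close> is the number of invisible pairs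
  in \<open>Q\<close>. If the visibility graph contained no copy of \<open>H\<close>, the Erdos-Stone theorem would therefore
  give \<open>f(Q) \<ge> (1/10 - o(1)) |Q|\<^sup>2\<close> for all large \<open>Q\<close> of this kind.

  By continuity in the direction, \<open>P\<close> can be cut by two parallel lines and one transversal into a
  \<open>2 \<times> 3\<close> grid of convex cells with about \<open>m = |P|/6\<close> points each. Each pair of points lies in at most
  one collinear triple. A triple inside a cell uses three pairs of points that lie in a common cell,
  and a triple inside the union of two adjacent cells uses at least one. Every cell takes part in
  exactly three of the terms on the left below, so counting these pairs gives
  \<open>\<Sum> f(corner) + \<Sum> f(union of two adjacent cells) \<le> 6 m\<^sup>2/2\<close>, with four corners and seven unions, all
  of them convex. The lower bound makes the left-hand side at least
  \<open>(4 + 7 \<cdot> 4)(1/10 - o(1)) m\<^sup>2 = (3.2 - o(1)) m\<^sup>2\<close>, a contradiction.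
\<close>

subsection \<open>The Erdos-Stone theorem\<close>

text \<open>For a loop-free \<open>E\<close> the sets \<open>K i\<close> are pairwise disjoint, as a
  common point of two of them would be adjacent to itself. So this is a complete
  \<open>j\<close>-partite subgraph with classes of size \<open>t\<close>; edges inside a class are
  allowed.\<close>

definition has_blowup :: "nat \<Rightarrow> nat \<Rightarrow> 'b set \<Rightarrow> ('b \<Rightarrow> 'b \<Rightarrow> bool) \<Rightarrow> bool" where
  "has_blowup j t V E \<longleftrightarrow> (\<exists>K. (\<forall>i<j. K i \<subseteq> V \<and> card (K i) = t) \<and>
     (\<forall>i<j. \<forall>i'<j. i \<noteq> i' \<longrightarrow> (\<forall>u\<in>K i. \<forall>v\<in>K i'. E u v)))"

definition nbhd :: "'b set \<Rightarrow> ('b \<Rightarrow> 'b \<Rightarrow> bool) \<Rightarrow> 'b \<Rightarrow> 'b set" where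
  "nbhd V E v = {u \<in> V. E v u}"

lemma has_blowup_mono:
  assumes "has_blowup j t S E" "S \<subseteq> V"
  shows "has_blowup j t V E"
proof -
  obtain K where "\<And>i. i < j \<Longrightarrow> K i \<subseteq> S \<and> card (K i) = t"
    "\<forall>i<j. \<forall>i'<j. i \<noteq> i' \<longrightarrow> (\<forall>u\<in>K i. \<forall>v\<in>K i'. E u v)"
    using assms(1) unfolding has_blowup_def by auto
  then show ?thesis
    unfolding has_blowup_def using assms(2) by (intro exI[of _ K]) (simp add: subset_trans[of _ S V])
qed

text \<open>There are only \<open>2 ^ card B\<close> possible values of \<open>T v\<close>. In the
  application \<open>T v\<close> is the set of neighbours of \<open>v\<close> in \<open>B\<close>,
  and the lemma supplies many vertices with the same neighbours there.\<close>

lemma pigeonhole_trace: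
  fixes T :: "'a \<Rightarrow> 'b set"
  assumes "finite B" "finite W" "\<And>v. v \<in> W \<Longrightarrow> T v \<subseteq> B" "t * 2 ^ card B < card W"
  obtains R where "R \<subseteq> B" "t \<le> card {v \<in> W. T v = R}"
proof -
  have "\<exists>R\<in>Pow B. t \<le> card {v \<in> W. T v = R}"
  proof (rule ccontr)
    assume neg: "\<not> ?thesis"
    have small: "card {v \<in> W. T v = R} \<le> t" if "R \<in> Pow B" for R
    proof (rule ccontr)
      assume "\<not> card {v \<in> W. T v = R} \<le> t"
      then have "t \<le> card {v \<in> W. T v = R}" by simp
      then show False using neg that by blast
    qed
    have "card W \<le> card (\<Union>R\<in>Pow B. {v \<in> W. T v = R})"
      using assms(1-3) by (intro card_mono) auto
    also have "\<dots> \<le> (\<Sum>R\<in>Pow B. card {v \<in> W. T v = R})"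
      using assms(1) by (intro card_UN_le) auto
    also have "\<dots> \<le> (\<Sum>R\<in>Pow B. t)"
      by (intro sum_mono small)
    also have "\<dots> = t * 2 ^ card B"
      using assms(1) by (simp add: card_Pow)
    finally show False using assms(4) by simp
  qed
  then show ?thesis using that by auto
qed

lemma sum_card_nbhd_swap:
  assumes "finite A" "finite B" "\<And>u v. E u v \<Longrightarrow> E v u"
  shows "(\<Sum>v\<in>A. card (nbhd B E v)) = (\<Sum>u\<in>B. card (nbhd A E u))"
proof -
  have c: "card (nbhd X E v) = (\<Sum>u\<in>X. of_bool (E v u))" if "finite X" for X v
    using that by (simp add: nbhd_def Collect_conj_eq)
  have "(\<Sum>v\<in>A. card (nbhd B E v)) = (\<Sum>v\<in>A. \<Sum>u\<in>B. of_bool (E v u))"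
    using assms by (simp add: c)
  also have "\<dots> = (\<Sum>u\<in>B. \<Sum>v\<in>A. of_bool (E v u))" by (rule sum.swap)
  also have "\<dots> = (\<Sum>u\<in>B. \<Sum>v\<in>A. of_bool (E u v))"
    using assms(3) by (intro sum.cong refl) (auto intro!: arg_cong[where f = of_bool])
  finally show ?thesis using assms by (simp add: c)
qed

text \<open>Double counting the edges between \<open>V\<close> and the \<open>j\<close> parts of size \<open>T\<close> yields many vertices with at
  least \<open>t\<close> neighbours in each part. By pigeonhole, \<open>t\<close> of them have the same neighbours there.\<close>

lemma has_blowup_step:
  fixes \<epsilon> \<gamma> :: real
  assumes "finite V" and sym: "\<And>u v. E u v \<Longrightarrow> E v u"
    and deg: "\<And>v. v \<in> V \<Longrightarrow> card (nbhd V E v) \<ge> \<gamma> * card V"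
    and j: "1 \<le> j" and \<gamma>: "real j * \<gamma> \<ge> real j - 1 + \<epsilon>" and "\<epsilon> > 0"
    and K: "has_blowup j T V E" and T: "\<epsilon> * T \<ge> 2 * real t" "T \<ge> 1"
    and V: "\<epsilon> * card V > 2 * real j * real t * 2 ^ (j * T)"
  shows "has_blowup (Suc j) t V E"
proof -
  obtain K where KV: "\<And>i. i < j \<Longrightarrow> K i \<subseteq> V" and Kc: "\<And>i. i < j \<Longrightarrow> card (K i) = T"
    and KE: "\<And>i i' u v. \<lbrakk>i < j; i' < j; i \<noteq> i'; u \<in> K i; v \<in> K i'\<rbrakk> \<Longrightarrow> E u v"
    using K unfolding has_blowup_def by metis
  define d where "d v = (\<Sum>i<j. card (nbhd (K i) E v))" for v
  define W where "W = {v \<in> V. \<forall>i<j. t \<le> card (nbhd (K i) E v)}"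
  define B where "B = (\<Union>i<j. K i)"
  have finK: "finite (K i)" if "i < j" for i
    using KV[OF that] \<open>finite V\<close> finite_subset by blast
  have B: "finite B" "card B \<le> j * T"
    using finK Kc card_UN_le[of "{..<j}" K] by (auto simp: B_def)
  have WV: "W \<subseteq> V" and finW: "finite W"
    using \<open>finite V\<close> by (auto simp: W_def)
  have nb_le: "card (nbhd (K i) E v) \<le> T" if "i < j" for i v
    using card_mono[OF finK[OF that], of "nbhd (K i) E v"] Kc[OF that] by (auto simp: nbhd_def)
  have dW: "d v \<le> j * T" for v
    using sum_bounded_above[of "{..<j}" "\<lambda>i. card (nbhd (K i) E v)" T] nb_le
    by (simp add: d_def)
  \<comment> \<open>A vertex outside \<open>W\<close> misses the bound in one part, where it has
    fewer than \<open>t\<close> neighbours; every other part contributes at most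
    \<open>T\<close>.\<close>
  have dn: "d v \<le> (j - 1) * T + t" if v: "v \<in> V - W" for v
  proof -
    obtain i where i: "i < j" "card (nbhd (K i) E v) < t"
      using v by (auto simp: W_def not_le)
    have "d v = card (nbhd (K i) E v) + (\<Sum>i\<in>{..<j} - {i}. card (nbhd (K i) E v))"
      unfolding d_def using i by (subst sum.remove[of _ i]) auto
    also have "(\<Sum>i\<in>{..<j} - {i}. card (nbhd (K i) E v)) \<le> (j - 1) * T"
      using sum_bounded_above[of "{..<j} - {i}" "\<lambda>i. card (nbhd (K i) E v)" T] nb_le i
      by simp
    finally show ?thesis using i by simp
  qed
  have rj: "real (j - 1) = real j - 1"
    using j by (simp add: of_nat_diff)
  have "j * T * (\<gamma> * card V) = (\<Sum>i<j. \<Sum>u\<in>K i. \<gamma> * card V)"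
    using Kc by simp
  also have "\<dots> \<le> (\<Sum>i<j. \<Sum>u\<in>K i. real (card (nbhd V E u)))"
    using KV by (intro sum_mono deg) auto
  also have "\<dots> = real (\<Sum>i<j. \<Sum>v\<in>V. card (nbhd (K i) E v))"
    using sum_card_nbhd_swap[OF finK \<open>finite V\<close>, of _ E] sym
    unfolding of_nat_sum[symmetric] by (intro arg_cong[where f = real] sum.cong[OF refl]) simp_all
  also have "(\<Sum>i<j. \<Sum>v\<in>V. card (nbhd (K i) E v)) = (\<Sum>v\<in>V. d v)"
    unfolding d_def by (rule sum.swap)
  also have "(\<Sum>v\<in>V. d v) = (\<Sum>v\<in>W. d v) + (\<Sum>v\<in>V-W. d v)"
    using WV \<open>finite V\<close> by (metis add.commute sum.subset_diff)
  also have "real \<dots> \<le> real (\<Sum>v\<in>W. j * T) + real (\<Sum>v\<in>V-W. (j - 1) * T + t)"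
    unfolding of_nat_add by (intro add_mono of_nat_mono sum_mono dW dn)
  also have "\<dots> \<le> real (card W) * (j * T) + real (card V) * ((j - 1) * T + t)"
    using card_mono[OF \<open>finite V\<close>, of "V - W"]
    by (simp only: sum_constant of_nat_mult) (intro add_mono mult_right_mono order_refl; simp)
  finally have main: "j * T * (\<gamma> * card V) \<le> real (card W) * (j * T) + real (card V) * (real (j - 1) * T + t)"
    by (simp add: mult.commute)
  \<comment> \<open>The contributions \<open>(j - 1) * T * card V\<close> on both sides cancel.
    Since \<open>2 * t \<le> \<epsilon> * T\<close>, at least half of
    \<open>\<epsilon> * T * card V\<close> survives the loss \<open>t * card V\<close>, so
    \<open>W\<close> has size linear in \<open>card V\<close>.\<close>
  have "T * (real j - 1 + \<epsilon>) * card V \<le> T * (real j * \<gamma>) * card V"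
    using \<gamma> by (intro mult_left_mono mult_right_mono) auto
  then have "T * (real j - 1 + \<epsilon>) * card V \<le> real (card W) * (j * T) + real (card V) * ((real j - 1) * T + t)"
    using main rj by (simp add: algebra_simps)
  then have "(\<epsilon> * T - t) * card V \<le> real (card W) * (j * T)"
    by (simp add: algebra_simps)
  moreover have "(\<epsilon> * T / 2) * card V \<le> (\<epsilon> * T - t) * card V"
    using T by (intro mult_right_mono) auto
  ultimately have "T * (\<epsilon> / 2 * card V) \<le> T * (real (card W) * j)"
    by (simp add: algebra_simps)
  then have "\<epsilon> / 2 * card V \<le> real (card W) * j"
    using T by simp
  then have "real j * (t * 2 ^ (j * T)) < j * real (card W)"
    using V by (simp add: algebra_simps)
  then have "real (t * 2 ^ (j * T)) < real (card W)"
    using j by simp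
  then have "t * 2 ^ (j * T) < card W"
    by (simp only: of_nat_less_iff)
  moreover have "t * 2 ^ card B \<le> t * 2 ^ (j * T)"
    using B by simp
  ultimately have "t * 2 ^ card B < card W" by linarith
  then obtain R where "R \<subseteq> B" and R: "t \<le> card {v \<in> W. nbhd B E v = R}"
    using pigeonhole_trace[OF B(1) finW, of "nbhd B E" t] by (auto simp: nbhd_def)
  obtain L where L: "L \<subseteq> {v \<in> W. nbhd B E v = R}" "card L = t"
    using obtain_subset_with_card_n[OF R] by blast
  \<comment> \<open>A vertex of \<open>L\<close> lies in \<open>W\<close> and has trace
    \<open>R\<close>, so \<open>R\<close> meets every part in at least \<open>t\<close> points. For
    \<open>t = 0\<close> there is no such vertex, and the empty set serves.\<close>
  have "\<exists>S. S \<subseteq> R \<inter> K i \<and> card S = t" if i: "i < j" for i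
  proof (cases "t = 0")
    case False
    then obtain v where v: "v \<in> L" using L by fastforce
    then have "nbhd (K i) E v = R \<inter> K i" "v \<in> W"
      using L i by (auto simp: B_def nbhd_def)
    then have "t \<le> card (R \<inter> K i)"
      using i by (auto simp: W_def)
    then show ?thesis by (metis obtain_subset_with_card_n)
  qed auto
  then obtain S where S: "\<And>i. i < j \<Longrightarrow> S i \<subseteq> R \<inter> K i" "\<And>i. i < j \<Longrightarrow> card (S i) = t"
    by metis
  define K' where "K' i = (if i < j then S i else L)" for i
  have SL: "E v u" if "i < j" "u \<in> S i" "v \<in> L" for i u v
    using that S(1)[of i] L(1) by (auto simp: nbhd_def)
  show ?thesis
    unfolding has_blowup_def
  proof (intro exI[of _ K'] conjI allI impI ballI)
    fix i assume "i < Suc j"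
    have "S i \<subseteq> V \<and> card (S i) = t" if "i < j"
      using S[OF that] KV[OF that] by auto
    moreover have "L \<subseteq> V \<and> card L = t"
      using L WV by auto
    ultimately show "K' i \<subseteq> V" "card (K' i) = t"
      by (simp_all add: K'_def)
  next
    fix i i' u v
    assume a: "i < Suc j" "i' < Suc j" "i \<noteq> i'" "u \<in> K' i" "v \<in> K' i'"
    consider "i < j" "i' < j" | "i < j" "i' = j" | "i = j" "i' < j"
      using a(1-3) by linarith
    then show "E u v"
    proof cases
      case 1
      then show ?thesis
        using a(3-5) S(1)[OF 1(1)] S(1)[OF 1(2)] by (intro KE[of i i']) (auto simp: K'_def)
    next
      case 2
      then show ?thesis
        using a(4,5) SL[of i u v] sym by (simp add: K'_def)
    next
      case 3
      then show ?thesis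
        using a(4,5) SL[of i' v u] by (simp add: K'_def)
    qed
  qed
qed

text \<open>Induction on the number of classes, with \<open>t\<close> arbitrary because each new
  class costs class size: classes of size \<open>t\<close> at stage \<open>Suc j\<close> come from
  classes of a larger size \<open>T\<close> at stage \<open>j\<close>. The bound
  \<open>j \<le> r\<close> turns the degree condition into
  \<open>j * \<gamma> \<ge> j - 1 + \<epsilon>\<close>, as the extension step requires.\<close>

lemma has_blowup_of_min_degree:
  fixes \<epsilon> :: real
  assumes "0 < \<epsilon>" "1 \<le> j" "j \<le> Suc r"
  shows "\<exists>N. \<forall>(V :: 'b set) E. finite V \<longrightarrow> N \<le> card V \<longrightarrow> (\<forall>u v. E u v \<longrightarrow> E v u) \<longrightarrow>
    (\<forall>v\<in>V. card (nbhd V E v) \<ge> (1 - 1 / r + \<epsilon>) * card V) \<longrightarrow> has_blowup j t V E"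
  using assms(2,3)
proof (induction j arbitrary: t rule: nat_induct_at_least)
  case base
  have "has_blowup 1 t V E" if "finite V" "t \<le> card V" for V :: "'b set" and E
  proof -
    obtain S where "S \<subseteq> V" "card S = t"
      using obtain_subset_with_card_n \<open>t \<le> card V\<close> by blast
    then show ?thesis
      unfolding has_blowup_def by (intro exI[of _ "\<lambda>_. S"]) auto
  qed
  then show ?case by blast
next
  case (Suc j)
  define \<gamma> where "\<gamma> = 1 - 1 / r + \<epsilon>"
  define T where "T = nat \<lceil>2 * t / \<epsilon>\<rceil> + 1"
  have "2 * t / \<epsilon> \<le> T" unfolding T_def by linarith
  then have T: "\<epsilon> * T \<ge> 2 * real t" "T \<ge> 1"
    using assms(1) by (simp_all add: field_simps T_def)
  have j: "1 \<le> j" "j \<le> r" using Suc by auto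
  have "real j * (1 / r) \<le> 1" using j by simp
  moreover have "\<epsilon> \<le> real j * \<epsilon>" using j assms(1) by simp
  ultimately have \<gamma>: "real j * \<gamma> \<ge> real j - 1 + \<epsilon>"
    by (simp add: \<gamma>_def algebra_simps)
  obtain N where N: "\<forall>(V :: 'b set) E. finite V \<longrightarrow> N \<le> card V \<longrightarrow> (\<forall>u v. E u v \<longrightarrow> E v u) \<longrightarrow>
      (\<forall>v\<in>V. card (nbhd V E v) \<ge> \<gamma> * card V) \<longrightarrow> has_blowup j T V E"
    using Suc.IH[of T] Suc_leD[OF Suc.prems] unfolding \<gamma>_def by blast
  \<comment> \<open>Beyond this size the linear lower bound for the set of good vertices exceeds
    \<open>t\<close> times the number \<open>2 ^ (j * T)\<close> of possible traces.\<close>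
  define M where "M = nat \<lceil>2 * j * t * 2 ^ (j * T) / \<epsilon>\<rceil> + 1"
  have "has_blowup (Suc j) t V E"
    if "finite V" "max N M \<le> card V" "\<And>u v. E u v \<Longrightarrow> E v u"
       "\<And>v. v \<in> V \<Longrightarrow> card (nbhd V E v) \<ge> \<gamma> * card V" for V :: "'b set" and E
  proof -
    have "2 * j * t * 2 ^ (j * T) / \<epsilon> < real M" unfolding M_def by linarith
    also have "\<dots> \<le> card V" using that(2) by simp
    finally have V: "\<epsilon> * card V > 2 * real j * real t * 2 ^ (j * T)"
      using assms(1) by (simp add: field_simps)
    have "has_blowup j T V E" using that N by simp
    then show ?thesis
      using that(1,3,4) j(1) \<gamma> assms(1) T V by (intro has_blowup_step[where \<epsilon> = \<epsilon> and T = T])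
  qed
  then show ?case
    unfolding \<gamma>_def by (intro exI[of _ "max N M"] allI impI) blast
qed

text \<open>A subset maximising \<open>2 e(S) - \<alpha> |S|\<^sup>2\<close> has large minimum degree, since no vertex can be removed
  with profit.\<close>

theorem erdos_stone:
  fixes \<epsilon> :: real
  assumes "0 < \<epsilon>" "1 \<le> r"
  shows "\<exists>N. \<forall>(V :: 'b set) E. finite V \<longrightarrow> N \<le> card V \<longrightarrow> (\<forall>u v. E u v \<longrightarrow> E v u) \<longrightarrow> (\<forall>v. \<not> E v v) \<longrightarrow>
    (\<Sum>v\<in>V. card (nbhd V E v)) \<ge> (1 - 1 / r + \<epsilon>) * (card V)\<^sup>2 \<longrightarrow> has_blowup (Suc r) t V E"
proof -
  \<comment> \<open>The surplus \<open>\<epsilon>\<close> is spent in portions: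
    \<open>\<epsilon> / 2\<close> keeps the maximiser large, a further \<open>\<epsilon> / 4\<close>
    absorbs a lower order term in the degree bound, and \<open>\<epsilon> / 4\<close> is left for
    the minimum degree version.\<close>
  define \<alpha> where "\<alpha> = 1 - 1 / r + \<epsilon> / 2"
  have "1 / real r \<le> 1" using assms by simp
  then have \<alpha>0: "\<alpha> \<ge> 0" using assms unfolding \<alpha>_def by linarith
  have "0 < \<epsilon> / 4" "1 \<le> Suc r" using assms(1) by auto
  then obtain N0 where N0: "\<forall>(V :: 'b set) E. finite V \<longrightarrow> N0 \<le> card V \<longrightarrow> (\<forall>u v. E u v \<longrightarrow> E v u) \<longrightarrow>
      (\<forall>v\<in>V. card (nbhd V E v) \<ge> (1 - 1 / r + \<epsilon> / 4) * card V) \<longrightarrow> has_blowup (Suc r) t V E"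
    using has_blowup_of_min_degree[of "\<epsilon> / 4" "Suc r" r t] by blast
  define M where "M = max N0 (nat \<lceil>2 * \<alpha> / \<epsilon>\<rceil>)"
  define N where "N = nat \<lceil>M / sqrt (\<epsilon> / 2)\<rceil>"
  have "has_blowup (Suc r) t V E"
    if fin: "finite V" and cV: "N \<le> card V" and sym: "\<And>u v. E u v \<Longrightarrow> E v u" and irr: "\<And>v. \<not> E v v"
      and e: "(\<Sum>v\<in>V. card (nbhd V E v)) \<ge> (1 - 1 / r + \<epsilon>) * (card V)\<^sup>2" for V :: "'b set" and E
  proof -
    define e where "e S = real (\<Sum>v\<in>S. card (nbhd S E v))" for S
    define \<Phi> where "\<Phi> S = e S - \<alpha> * (card S)\<^sup>2" for S
    obtain S where "S \<in> Pow V" and max: "\<And>S'. S' \<in> Pow V \<Longrightarrow> \<Phi> S' \<le> \<Phi> S"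
    proof -
      have "Max (\<Phi> ` Pow V) \<in> \<Phi> ` Pow V"
        using fin by (intro Max_in) auto
      then obtain S where "S \<in> Pow V" "\<Phi> S = Max (\<Phi> ` Pow V)" by auto
      then show ?thesis using that[of S] fin by simp
    qed
    then have SV: "S \<subseteq> V" and finS: "finite S"
      using fin finite_subset by auto
    have "e S \<le> real (\<Sum>v\<in>S. card S)"
      unfolding e_def using finS by (intro of_nat_mono sum_mono card_mono) (auto simp: nbhd_def)
    then have "e S \<le> (card S)\<^sup>2" by (simp add: power2_eq_square)
    moreover have "0 \<le> \<alpha> * (card S)\<^sup>2" using \<alpha>0 by simp
    ultimately have "\<Phi> S \<le> (card S)\<^sup>2" unfolding \<Phi>_def by linarith
    \<comment> \<open>Together with \<open>\<Phi> S \<le> (card S)\<^sup>2\<close> and the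
      maximality of \<open>S\<close> this bounds \<open>card S\<close> from below by a constant
      multiple of \<open>card V\<close>.\<close>
    moreover have "\<Phi> V \<ge> \<epsilon> / 2 * (card V)\<^sup>2"
      using e by (simp add: \<Phi>_def e_def \<alpha>_def algebra_simps)
    ultimately have "\<epsilon> / 2 * (card V)\<^sup>2 \<le> (real (card S))\<^sup>2"
      using max[of V] by simp
    then have "sqrt (\<epsilon> / 2 * (card V)\<^sup>2) \<le> card S"
      by (intro real_le_lsqrt) auto
    then have "sqrt (\<epsilon> / 2) * card V \<le> card S"
      unfolding real_sqrt_mult by simp
    moreover have "M / sqrt (\<epsilon> / 2) \<le> card V"
      using cV unfolding N_def by linarith
    ultimately have SM: "M \<le> card S"
      using assms(1) by (simp add: pos_divide_le_eq mult.commute)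
    have deg: "card (nbhd S E v) \<ge> (1 - 1 / r + \<epsilon> / 4) * card S" if v: "v \<in> S" for v
    proof -
      have nb: "card (nbhd S E u) = card (nbhd (S - {v}) E u) + of_bool (E u v)" for u
      proof -
        have "nbhd S E u = nbhd (S - {v}) E u \<union> (if E u v then {v} else {})"
          using v by (auto simp: nbhd_def)
        then show ?thesis using finS by (auto simp: nbhd_def)
      qed
      have "(\<Sum>u\<in>S. card (nbhd S E u)) = card (nbhd S E v) + (\<Sum>u\<in>S-{v}. card (nbhd S E u))"
        using finS v by (simp add: sum.remove)
      also have "(\<Sum>u\<in>S-{v}. card (nbhd S E u))
          = (\<Sum>u\<in>S-{v}. card (nbhd (S - {v}) E u)) + (\<Sum>u\<in>S-{v}. of_bool (E u v))"
        by (simp add: nb sum.distrib)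
      \<comment> \<open>The degree sum counts each edge at \<open>v\<close> twice, once at
        \<open>v\<close> and once at the other end. Hence removing \<open>v\<close> lowers it by
        twice the degree of \<open>v\<close>.\<close>
      also have "(\<Sum>u\<in>S-{v}. of_bool (E u v)) = card (nbhd S E v)"
      proof -
        have "{u \<in> S - {v}. E u v} = nbhd S E v"
          using sym irr by (auto simp: nbhd_def)
        then show ?thesis using finS by (simp add: Int_def)
      qed
      finally have "e S = e (S - {v}) + 2 * card (nbhd S E v)"
        by (simp add: e_def)
      moreover have "\<Phi> (S - {v}) \<le> \<Phi> S"
        using SV by (intro max) auto
      moreover have "real (card (S - {v})) = real (card S) - 1"
        using card.remove[OF finS v] by simp
      ultimately have "\<alpha> * (2 * real (card S) - 1) \<le> 2 * card (nbhd S E v)"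
        by (simp add: \<Phi>_def power2_eq_square algebra_simps)
      \<comment> \<open>The preceding bound gives degree at least
        \<open>\<alpha> * card S - \<alpha> / 2\<close>, and the second entry of \<open>M\<close>
        makes \<open>\<alpha> / 2\<close> at most \<open>\<epsilon> / 4 * card S\<close>.\<close>
      moreover have "2 * \<alpha> / \<epsilon> \<le> card S"
        using SM unfolding M_def by linarith
      then have "2 * \<alpha> \<le> \<epsilon> * card S"
        using assms(1) by (simp add: pos_divide_le_eq mult.commute)
      ultimately show ?thesis
        by (simp add: \<alpha>_def algebra_simps)
    qed
    have "has_blowup (Suc r) t S E"
      using N0[rule_format, OF finS _ _ deg] SM sym by (simp add: M_def)
    then show ?thesis
      using SV by (rule has_blowup_mono)
  qed
  then show ?thesis
    by (intro exI[of _ N] allI impI) blast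
qed

text \<open>Vertices of colour \<open>i\<close> are sent into the class \<open>K i\<close>. Each
  class has as many elements as all of \<open>H\<close>, so bijections \<open>g i\<close> defined on
  the whole vertex set can be glued along the colours. Vertices of different colours get adjacent
  images, which are distinct because the graph has no loops.\<close>

lemma contains_copy_of_blowup:
  assumes H: "pair_graph H" and G: "pair_graph G" and c: "proper_coloring H k c"
    and b: "has_blowup k (card (pverts H)) (pverts G) (\<lambda>u v. (u, v) \<in> parcs G)"
  shows "contains_copy G H"
proof -
  interpret H: pair_graph H by fact
  interpret G: pair_graph G by fact
  let ?t = "card (pverts H)"
  obtain K where K: "\<And>i. i < k \<Longrightarrow> K i \<subseteq> pverts G" "\<And>i. i < k \<Longrightarrow> card (K i) = ?t"
    "\<And>i i' u v. \<lbrakk>i < k; i' < k; i \<noteq> i'; u \<in> K i; v \<in> K i'\<rbrakk> \<Longrightarrow> (u, v) \<in> parcs G"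
    using b unfolding has_blowup_def by metis
  have ck: "c v < k" if "v \<in> pverts H" for v
    using c that by (auto simp: proper_coloring_def)
  have "\<exists>g. bij_betw g (pverts H) (K i)" if i: "i < k" for i
    using K(1,2)[OF i] finite_subset[OF _ G.pair_finite_verts] H.pair_finite_verts
    by (metis finite_same_card_bij)
  then obtain g where g: "\<And>i. i < k \<Longrightarrow> bij_betw (g i) (pverts H) (K i)" by metis
  define f where "f v = g (c v) v" for v
  have fK: "f v \<in> K (c v)" if "v \<in> pverts H" for v
    using g[OF ck[OF that]] that by (auto simp: f_def bij_betw_def)
  have "inj_on f (pverts H)"
  proof (rule inj_onI)
    fix u v assume uv: "u \<in> pverts H" "v \<in> pverts H" "f u = f v"
    have "c u = c v"
    proof (rule ccontr)
      assume "c u \<noteq> c v"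
      then have "(f u, f v) \<in> parcs G"
        using uv(1,2) ck fK by (intro K(3)[of "c u" "c v"])
      then show False using uv(3) G.pair_no_loops[of "(f u, f v)"] by simp
    qed
    then have "g (c u) u = g (c u) v"
      using uv(3) by (simp add: f_def)
    then show "u = v"
      using inj_onD[OF bij_betw_imp_inj_on[OF g[OF ck[OF uv(1)]]]] uv(1,2) by blast
  qed
  moreover have "f ` pverts H \<subseteq> pverts G"
    using fK K(1)[OF ck] by auto
  moreover have "(f u, f v) \<in> parcs G" if "(u, v) \<in> parcs H" for u v
  proof -
    have "c u \<noteq> c v" using c that by (auto simp: proper_coloring_def)
    then show ?thesis
      using H.in_arcsD1[OF that] H.in_arcsD2[OF that] fK ck by (intro K(3)[of "c u" "c v"])
  qed
  ultimately show ?thesis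
    unfolding contains_copy_iff[OF H G] by (intro exI[of _ f]) auto
qed

subsection \<open>Counting collinear triples\<close>

text \<open>The grid has rows \<open>a, b, c\<close> and \<open>d, e, f\<close>. The four corners and the seven pairs of adjacent cells
  occur on the left.\<close>

lemma grid_arith:
  fixes a b c d e f :: nat
  assumes "a + b + c + d + e + f \<le> 3"
  shows "of_bool (a = 3) + of_bool (c = 3) + of_bool (d = 3) + of_bool (f = 3)
    + of_bool (a + b = 3) + of_bool (b + c = 3) + of_bool (d + e = 3) + of_bool (e + f = 3)
    + of_bool (a + d = 3) + of_bool (b + e = 3) + of_bool (c + f = 3)
    \<le> (a choose 2) + (b choose 2) + (c choose 2) + (d choose 2) + (e choose 2) + (f choose 2)"
proof -
  \<comment> \<open>The nested ranges list exactly the sextuples with sum at most 3, and the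
    inequality is decided by evaluation on this finite list.\<close>
  have "\<forall>a\<in>set [0..<4]. \<forall>b\<in>set [0..<4-a]. \<forall>c\<in>set [0..<4-a-b]. \<forall>d\<in>set [0..<4-a-b-c].
    \<forall>e\<in>set [0..<4-a-b-c-d]. \<forall>f\<in>set [0..<4-a-b-c-d-e].
    of_bool (a = 3) + of_bool (c = 3) + of_bool (d = 3) + of_bool (f = 3)
    + of_bool (a + b = 3) + of_bool (b + c = 3) + of_bool (d + e = 3) + of_bool (e + f = 3)
    + of_bool (a + d = 3) + of_bool (b + e = 3) + of_bool (c + f = 3)
    \<le> (a choose 2) + (b choose 2) + (c choose 2) + (d choose 2) + (e choose 2) + (f choose 2)"
    by code_simp
  moreover have "a \<in> set [0..<4]" "b \<in> set [0..<4-a]" "c \<in> set [0..<4-a-b]" "d \<in> set [0..<4-a-b-c]"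
    "e \<in> set [0..<4-a-b-c-d]" "f \<in> set [0..<4-a-b-c-d-e]"
    using assms by auto
  ultimately show ?thesis by blast
qed

text \<open>Two members of \<open>\<T>\<close> share at most one point, so no pair of points of
  \<open>A\<close> lies in both. The left-hand side therefore counts distinct pairs of points of
  \<open>A\<close>.\<close>

lemma sum_choose_two_le:
  assumes "finite A" "finite \<T>"
    and "\<And>T. T \<in> \<T> \<Longrightarrow> card T = 3" "\<And>T T'. \<lbrakk>T \<in> \<T>; T' \<in> \<T>; T \<noteq> T'\<rbrakk> \<Longrightarrow> card (T \<inter> T') \<le> 1"
  shows "(\<Sum>T\<in>\<T>. card (T \<inter> A) choose 2) \<le> card A choose 2"
proof -
  let ?S = "\<lambda>X. {K. K \<subseteq> X \<and> card K = 2}"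
  have fin: "finite T" if "T \<in> \<T>" for T
    using assms(3)[OF that] card.infinite by fastforce
  have "?S (T \<inter> A) \<inter> ?S (T' \<inter> A) = {}" if "T \<in> \<T>" "T' \<in> \<T>" "T \<noteq> T'" for T T'
  proof -
    have "card K \<le> 1" if "K \<subseteq> T \<inter> A" "K \<subseteq> T' \<inter> A" for K
    proof -
      have "card K \<le> card (T \<inter> T')"
        using that fin[OF \<open>T \<in> \<T>\<close>] by (intro card_mono) auto
      then show ?thesis
        using assms(4)[OF \<open>T \<in> \<T>\<close> \<open>T' \<in> \<T>\<close> \<open>T \<noteq> T'\<close>] by linarith
    qed
    then have "K \<notin> ?S (T' \<inter> A)" if "K \<in> ?S (T \<inter> A)" for K
      using that by (metis (mono_tags, lifting) mem_Collect_eq numeral_le_one_iff semiring_norm(69))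
    then show ?thesis by blast
  qed
  then have "card (\<Union>T\<in>\<T>. ?S (T \<inter> A)) = (\<Sum>T\<in>\<T>. card (?S (T \<inter> A)))"
    using assms(1,2) by (intro card_UN_disjoint) auto
  also have "\<dots> = (\<Sum>T\<in>\<T>. card (T \<inter> A) choose 2)"
    using assms(1) by (intro sum.cong refl n_subsets) auto
  finally have "(\<Sum>T\<in>\<T>. card (T \<inter> A) choose 2) = card (\<Union>T\<in>\<T>. ?S (T \<inter> A))" ..
  also have "\<dots> \<le> card (?S A)"
    using assms(1) by (intro card_mono) auto
  also have "\<dots> = card A choose 2"
    using assms(1) by (rule n_subsets)
  finally show ?thesis .
qed

text \<open>For each triple, \<open>grid_arith\<close> is applied to the numbers of its points in
  the six cells. Summing over \<open>\<T>\<close> and exchanging the sums leaves one instance of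
  \<open>sum_choose_two_le\<close> per cell.\<close>

lemma grid_count:
  fixes A :: "nat \<Rightarrow> 'a set"
  assumes fin: "\<And>i. finite (A i)" "finite \<T>" and disj: "\<And>i j. i \<noteq> j \<Longrightarrow> A i \<inter> A j = {}"
    and three: "\<And>T. T \<in> \<T> \<Longrightarrow> card T = 3"
    and lin: "\<And>T T'. \<lbrakk>T \<in> \<T>; T' \<in> \<T>; T \<noteq> T'\<rbrakk> \<Longrightarrow> card (T \<inter> T') \<le> 1"
  defines "n \<equiv> \<lambda>X. card {T \<in> \<T>. T \<subseteq> X}"
  shows "n (A 0) + n (A 2) + n (A 3) + n (A 5)
    + n (A 0 \<union> A 1) + n (A 1 \<union> A 2) + n (A 3 \<union> A 4) + n (A 4 \<union> A 5)
    + n (A 0 \<union> A 3) + n (A 1 \<union> A 4) + n (A 2 \<union> A 5)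
    \<le> (\<Sum>i<6. card (A i) choose 2)"
proof -
  have n: "n X = (\<Sum>T\<in>\<T>. of_bool (T \<subseteq> X))" for X
    using fin(2) by (simp add: n_def Int_def)
  let ?t = "\<lambda>T i. card (T \<inter> A i)"
  have pt: "of_bool (T \<subseteq> A 0) + of_bool (T \<subseteq> A 2) + of_bool (T \<subseteq> A 3) + of_bool (T \<subseteq> A 5)
    + of_bool (T \<subseteq> A 0 \<union> A 1) + of_bool (T \<subseteq> A 1 \<union> A 2) + of_bool (T \<subseteq> A 3 \<union> A 4) + of_bool (T \<subseteq> A 4 \<union> A 5)
    + of_bool (T \<subseteq> A 0 \<union> A 3) + of_bool (T \<subseteq> A 1 \<union> A 4) + of_bool (T \<subseteq> A 2 \<union> A 5)
    \<le> (\<Sum>i<6. ?t T i choose 2)" (is "?l \<le> ?r") if T: "T \<in> \<T>" for T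
  proof -
    have finT: "finite T" using three[OF T] card.infinite by fastforce
    \<comment> \<open>The cells are disjoint but need not cover \<open>T\<close>, so the counts sum
      to at most 3.\<close>
    have "(\<Sum>i<6. ?t T i) = card (\<Union>i\<in>{..<6}. T \<inter> A i)"
      using finT disj by (intro card_UN_disjoint[symmetric]) blast+
    also have "\<dots> \<le> card T"
      using finT by (intro card_mono) auto
    finally have "?t T 0 + ?t T 1 + ?t T 2 + ?t T 3 + ?t T 4 + ?t T 5 \<le> 3"
      using three[OF T] by (simp add: eval_nat_numeral)
    note ar = grid_arith[OF this]
    have b1: "T \<subseteq> A i \<Longrightarrow> ?t T i = 3" for i
      using three[OF T] by (simp add: Int_absorb2)
    have b2: "?t T i + ?t T j = 3" if "T \<subseteq> A i \<union> A j" "i \<noteq> j" for i j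
    proof -
      have "?t T i + ?t T j = card ((T \<inter> A i) \<union> (T \<inter> A j))"
        using finT disj[OF that(2)] by (intro card_Un_disjoint[symmetric]) auto
      also have "(T \<inter> A i) \<union> (T \<inter> A j) = T" using that by auto
      finally show ?thesis using three[OF T] by simp
    qed
    have m: "of_bool p \<le> (of_bool q :: nat)" if "p \<Longrightarrow> q" for p q
      using that by auto
    have "?l \<le> of_bool (?t T 0 = 3) + of_bool (?t T 2 = 3) + of_bool (?t T 3 = 3) + of_bool (?t T 5 = 3)
    + of_bool (?t T 0 + ?t T 1 = 3) + of_bool (?t T 1 + ?t T 2 = 3) + of_bool (?t T 3 + ?t T 4 = 3)
    + of_bool (?t T 4 + ?t T 5 = 3) + of_bool (?t T 0 + ?t T 3 = 3) + of_bool (?t T 1 + ?t T 4 = 3)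
    + of_bool (?t T 2 + ?t T 5 = 3)"
      by (intro add_mono m b1 b2) auto
    also note ar
    also have "(?t T 0 choose 2) + (?t T 1 choose 2) + (?t T 2 choose 2) + (?t T 3 choose 2) +
        (?t T 4 choose 2) + (?t T 5 choose 2) = ?r"
      by (simp add: eval_nat_numeral)
    finally show ?thesis .
  qed
  have "n (A 0) + n (A 2) + n (A 3) + n (A 5)
    + n (A 0 \<union> A 1) + n (A 1 \<union> A 2) + n (A 3 \<union> A 4) + n (A 4 \<union> A 5)
    + n (A 0 \<union> A 3) + n (A 1 \<union> A 4) + n (A 2 \<union> A 5) \<le> (\<Sum>T\<in>\<T>. \<Sum>i<6. ?t T i choose 2)"
    unfolding n sum.distrib[symmetric] by (intro sum_mono pt)
  also have "\<dots> = (\<Sum>i<6. \<Sum>T\<in>\<T>. ?t T i choose 2)" by (rule sum.swap)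
  also have "\<dots> \<le> (\<Sum>i<6. card (A i) choose 2)"
    using fin three lin by (intro sum_mono sum_choose_two_le) auto
  finally show ?thesis .
qed

section \<open>Collinear triples and invisible pairs\<close>

definition triples :: "'b::euclidean_space set \<Rightarrow> 'b set set" where
  "triples X = {T. T \<subseteq> X \<and> card T = 3 \<and> collinear T}"

text \<open>Two collinear triples with two common points lie on the same line. If they differ, their
  union contains four collinear points.\<close>

lemma triples_Int:
  assumes "\<not> has_four_collinear P" "T \<in> triples P" "T' \<in> triples P" "T \<noteq> T'"
  shows "card (T \<inter> T') \<le> 1"
proof (rule ccontr)
  assume "\<not> ?thesis"
  then have two: "2 \<le> card (T \<inter> T')" by simp
  have fin: "finite T" "finite T'"
    using assms(2,3) card.infinite by (fastforce simp: triples_def)+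
  obtain K where K: "K \<subseteq> T \<inter> T'" "card K = 2"
    using obtain_subset_with_card_n[OF two] by blast
  then obtain a b where ab: "K = {a, b}" "a \<noteq> b" by (meson card_2_iff)
  have finK: "finite K" using ab by simp
  have "card (T - K) = 1" "card (T' - K) = 1"
    using assms(2,3) K card_Diff_subset[OF finK] by (auto simp: triples_def)
  then obtain c d where c: "T - K = {c}" and d: "T' - K = {d}"
    by (meson card_1_singletonE)
  have T: "T = {a, b, c}" and T': "T' = {a, b, d}"
    using c d K ab by auto
  have "c \<noteq> d" using T T' assms(4) by auto
  moreover have "c \<notin> K" "d \<notin> K" using c d by auto
  ultimately have "card {a, b, c, d} = 4" using ab by auto
  moreover have "collinear {a, b, c, d}"
    using collinear_4_3[OF ab(2)] assms(2,3) T T' by (auto simp: triples_def)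
  moreover have "{a, b, c, d} \<subseteq> P"
    using assms(2,3) T T' by (auto simp: triples_def)
  ultimately show False using assms(1) unfolding has_four_collinear_def by blast
qed

text \<open>The middle point is the one for which the distances to the other two add up to the
  distance between those two. Two different middle points would force one of the positive distances
  to vanish.\<close>

lemma open_segment_middle_unique:
  fixes p q r :: "'b::euclidean_space"
  assumes "r \<in> open_segment p q" "r' \<in> open_segment p' q'" "{p, q, r} = {p', q', r'}"
  shows "{p', q'} = {p, q}"
proof -
  have d: "dist p q = dist p r + dist r q" "dist p' q' = dist p' r' + dist r' q'"
    using assms(1,2) by (auto simp: open_segment_def between_mem_segment[symmetric] between)
  have ne: "r \<noteq> p" "r \<noteq> q" "p \<noteq> q" "r' \<noteq> p'" "r' \<noteq> q'" "p' \<noteq> q'"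
    using assms(1,2) by (auto simp: open_segment_def)
  have pos: "dist p r > 0" "dist q r > 0" using ne by auto
  have mem: "p' \<in> {p, q, r}" "q' \<in> {p, q, r}" "r' \<in> {p, q, r}"
    unfolding assms(3) by auto
  have sym: "dist q p = dist p q" "dist r p = dist p r" "dist r q = dist q r"
    by (simp_all add: dist_commute)
  consider "p' = p" "q' = q" | "p' = q" "q' = p" | "p' = p" "q' = r" "r' = q" | "p' = r" "q' = p" "r' = q"
    | "p' = q" "q' = r" "r' = p" | "p' = r" "q' = q" "r' = p"
    using mem ne(4-6) by (elim insertE emptyE) simp_all
  then show ?thesis
  proof cases
    case 1
    then show ?thesis by simp
  next
    case 2
    then show ?thesis by auto
  qed (use d pos in \<open>simp_all add: sym\<close>)
qed

text \<open>An invisible pair is blocked by a point of \<open>P\<close> on its open segment; by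
  convexity the blocker lies in \<open>Q\<close>, so it completes the pair to a collinear triple.
  The triple determines its two ends, so it arises from at most two ordered pairs, which explains
  the factor 2.\<close>

lemma card_not_visible_le:
  assumes "finite P" "Q = P \<inter> C" "convex C"
  shows "card {(p, q). p \<in> Q \<and> q \<in> Q \<and> p \<noteq> q \<and> \<not> visible P p q} \<le> 2 * card (triples Q)"
proof -
  let ?I = "{(p, q). p \<in> Q \<and> q \<in> Q \<and> p \<noteq> q \<and> \<not> visible P p q}"
  have finQ: "finite Q" using assms by simp
  have finI: "finite ?I"
    by (rule finite_subset[of _ "Q \<times> Q"]) (use finQ in auto)
  define m where "m p q = (SOME r. r \<in> open_segment p q \<and> r \<in> P)" for p q
  have m: "m p q \<in> open_segment p q \<and> m p q \<in> P" if "(p, q) \<in> ?I" for p q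
    unfolding m_def by (rule someI_ex) (use that assms(2) in \<open>auto simp: visible_def\<close>)
  define h where "h = (\<lambda>(p, q). {p, q, m p q})"
  have hT: "h ` ?I \<subseteq> triples Q"
  proof
    fix T assume "T \<in> h ` ?I"
    then obtain p q where pq: "(p, q) \<in> ?I" and T: "T = {p, q, m p q}"
      by (auto simp: h_def)
    have "open_segment p q \<subseteq> C"
      using pq assms(2) convex_contains_open_segment[of C] assms(3) by auto
    then have "m p q \<in> Q" using m[OF pq] assms(2) by auto
    moreover have "m p q \<noteq> p" "m p q \<noteq> q" using m[OF pq] by (auto simp: open_segment_def)
    moreover have "collinear {p, q, m p q}"
      using m[OF pq] between_imp_collinear[of p q "m p q"]
      by (auto simp: open_segment_def between_mem_segment insert_commute)
    ultimately show "T \<in> triples Q" using pq T by (auto simp: triples_def)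
  qed
  have "card ?I \<le> (\<Sum>T\<in>h ` ?I. card {x \<in> ?I. h x = T})"
  proof -
    have "?I = (\<Union>T\<in>h ` ?I. {x \<in> ?I. h x = T})" by auto
    then have "card ?I = card (\<Union>T\<in>h ` ?I. {x \<in> ?I. h x = T})" by simp
    also have "\<dots> \<le> (\<Sum>T\<in>h ` ?I. card {x \<in> ?I. h x = T})"
      using finI by (intro card_UN_le) auto
    finally show ?thesis .
  qed
  also have "\<dots> \<le> (\<Sum>T\<in>h ` ?I. 2)"
  proof (rule sum_mono)
    fix T assume "T \<in> h ` ?I"
    then obtain p q where pq: "(p, q) \<in> ?I" and T: "T = {p, q, m p q}"
      by (auto simp: h_def)
    have "{x \<in> ?I. h x = T} \<subseteq> {(p, q), (q, p)}"
    proof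
      fix x assume x: "x \<in> {x \<in> ?I. h x = T}"
      obtain p' q' where [simp]: "x = (p', q')" by force
      have x': "(p', q') \<in> ?I" "{p', q', m p' q'} = {p, q, m p q}"
        using x T by (auto simp: h_def)
      have "{p', q'} = {p, q}"
        using m[OF pq] m[OF x'(1)] x'(2) by (intro open_segment_middle_unique) auto
      then show "x \<in> {(p, q), (q, p)}"
        by (auto simp: doubleton_eq_iff)
    qed
    then have "card {x \<in> ?I. h x = T} \<le> card {(p, q), (q, p)}"
      by (rule card_mono[rotated]) simp
    also have "\<dots> \<le> 2" by (cases "p = q") simp_all
    finally show "card {x \<in> ?I. h x = T} \<le> 2" .
  qed
  also have "\<dots> = 2 * card (h ` ?I)" by simp
  also have "\<dots> \<le> 2 * card (triples Q)"
    using card_mono[OF _ hT] finQ by (simp add: triples_def)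
  finally show ?thesis .
qed

subsection \<open>Equipartition into a grid of six cells\<close>

text \<open>The sign function is smoothed to a strictly increasing odd function, so that balanced cuts exist, are
  unique and depend continuously on the direction.\<close>

definition soft_sgn :: "real \<Rightarrow> real \<Rightarrow> real" where
  "soft_sgn \<eta> z = z / (\<eta> + \<bar>z\<bar>)"

lemma soft_sgn_minus [simp]: "soft_sgn \<eta> (- z) = - soft_sgn \<eta> z"
  by (simp add: soft_sgn_def)

lemma soft_sgn_strict_mono:
  assumes "0 < \<eta>" "z < z'"
  shows "soft_sgn \<eta> z < soft_sgn \<eta> z'"
proof -
  have pos: "0 < \<eta> + \<bar>z\<bar>" "0 < \<eta> + \<bar>z'\<bar>" using assms by auto
  have "z * (\<eta> + \<bar>z'\<bar>) < z' * (\<eta> + \<bar>z\<bar>)"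
  proof -
    have "z * \<eta> < z' * \<eta>" using assms by simp
    moreover have "z * \<bar>z'\<bar> \<le> z' * \<bar>z\<bar>"
    proof (cases "z \<ge> 0")
      case True
      then show ?thesis using assms by simp
    next
      case False
      then show ?thesis
        using assms by (cases "z' \<ge> 0") (auto simp: mult_nonpos_nonneg mult_less_0_iff intro: order_trans[of _ 0])
    qed
    ultimately show ?thesis by (simp add: algebra_simps)
  qed
  then show ?thesis using pos by (simp add: soft_sgn_def divide_simps)
qed

lemma soft_sgn_mono: "\<lbrakk>0 < \<eta>; z \<le> z'\<rbrakk> \<Longrightarrow> soft_sgn \<eta> z \<le> soft_sgn \<eta> z'"
  using soft_sgn_strict_mono[of \<eta> z z'] by (cases "z = z'") auto

lemma abs_soft_sgn_le: "0 < \<eta> \<Longrightarrow> \<bar>soft_sgn \<eta> z\<bar> \<le> 1"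
  by (simp add: soft_sgn_def abs_divide divide_le_eq)

text \<open>The error is exactly \<open>\<eta> / (\<eta> + \<bar>z\<bar>)\<close>. With
  \<open>\<eta> * card P \<le> \<delta>\<close> the errors at all points at distance at least
  \<open>\<delta>\<close> from a cut add up to at most 1.\<close>

lemma soft_sgn_near_sgn:
  assumes "0 < \<eta>" "0 < \<delta>" "\<delta> \<le> \<bar>z\<bar>"
  shows "\<bar>soft_sgn \<eta> z - sgn z\<bar> \<le> \<eta> / \<delta>"
proof -
  have "soft_sgn \<eta> z - sgn z = - sgn z * (\<eta> / (\<eta> + \<bar>z\<bar>))"
    using assms by (cases "z > 0") (auto simp: soft_sgn_def field_simps sgn_if)
  then have "\<bar>soft_sgn \<eta> z - sgn z\<bar> = \<eta> / (\<eta> + \<bar>z\<bar>)"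
    using assms by (auto simp: abs_mult abs_sgn_eq)
  also have "\<dots> \<le> \<eta> / \<delta>"
    using assms by (intro divide_left_mono) auto
  finally show ?thesis .
qed

lemma continuous_on_soft_sgn [continuous_intros]:
  assumes "0 < \<eta>" "continuous_on A f"
  shows "continuous_on A (\<lambda>t. soft_sgn \<eta> (f t))"
  unfolding soft_sgn_def using assms
  by (intro continuous_intros) (auto simp: add_nonneg_eq_0_iff)

text \<open>An intermediate value theorem with parameter. Strict monotonicity makes
  \<open>l < g x\<close> equivalent to \<open>F x l < 0\<close>, and \<open>g x < l\<close> to
  \<open>0 < F x l\<close>; for fixed \<open>l\<close> both are open conditions on \<open>x\<close>,
  which is the continuity of \<open>g\<close>. The parameter space is kept general because it is
  used for directions and for pairs of a direction and a slope.\<close>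

lemma continuous_root:
  fixes F :: "'a::topological_space \<Rightarrow> real \<Rightarrow> real"
  assumes cont1: "\<And>t. continuous_on UNIV (\<lambda>x. F x t)" and cont2: "\<And>x. continuous_on UNIV (F x)"
    and mono: "\<And>x s t. s < t \<Longrightarrow> F x s < F x t"
    and neg: "\<And>x. \<exists>t. F x t \<le> 0" and pos: "\<And>x. \<exists>t. 0 \<le> F x t"
  obtains g where "continuous_on UNIV g" "\<And>x t. F x t = 0 \<longleftrightarrow> t = g x" "\<And>x t. F x t \<le> 0 \<longleftrightarrow> t \<le> g x"
proof -
  have ex: "\<exists>t. F x t = 0" for x
  proof -
    obtain s t where st: "F x s \<le> 0" "0 \<le> F x t" using neg pos by blast
    then have "s \<le> t" using mono[of t s x] by (cases "s \<le> t") auto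
    then show ?thesis
      using IVT'[of "F x" s 0 t] st continuous_on_subset[OF cont2] by blast
  qed
  define g where "g x = (SOME t. F x t = 0)" for x
  have g0: "F x (g x) = 0" for x
    unfolding g_def using ex by (rule someI_ex)
  have eq: "F x t = 0 \<longleftrightarrow> t = g x" for x t
    using g0[of x] mono[of t "g x" x] mono[of "g x" t x] by (cases t "g x" rule: linorder_cases) auto
  have le: "F x t \<le> 0 \<longleftrightarrow> t \<le> g x" for x t
    using g0[of x] mono[of t "g x" x] mono[of "g x" t x] by (cases t "g x" rule: linorder_cases) auto
  have lt: "F x t < 0 \<longleftrightarrow> t < g x" for x t
    using le[of x t] eq[of x t] by linarith
  have "(g \<longlongrightarrow> g x) (at x)" for x
  proof (rule order_tendstoI)
    fix l assume "l < g x"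
    then have "F x l < 0" using lt by simp
    moreover have "((\<lambda>x. F x l) \<longlongrightarrow> F x l) (at x)"
      using cont1[of l] by (simp add: continuous_on_def)
    ultimately have "\<forall>\<^sub>F x in at x. F x l < 0" by (metis order_tendstoD(2))
    then show "\<forall>\<^sub>F x in at x. l < g x" by (simp add: lt)
  next
    fix l assume "g x < l"
    then have "0 < F x l" using le[of x l] by simp
    moreover have "((\<lambda>x. F x l) \<longlongrightarrow> F x l) (at x)"
      using cont1[of l] by (simp add: continuous_on_def)
    ultimately have "\<forall>\<^sub>F x in at x. 0 < F x l" by (metis order_tendstoD(1))
    then show "\<forall>\<^sub>F x in at x. g x < l"
      by (rule eventually_mono) (use le in \<open>simp add: not_le[symmetric]\<close>)
  qed
  then have "continuous_on UNIV g" by (simp add: continuous_on_def)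
  then show ?thesis using that eq le by blast
qed

text \<open>Translates a soft balance into a count of the points of \<open>S\<close> on the two
  sides of a cut. Each of the at most \<open>k\<close> points with wrong weight costs at most 1,
  each of the at most three points near the cut at most 2, and the smoothing at most 1 in total,
  hence \<open>k + 7\<close>. The conditions on \<open>A\<close> let points on the cut itself go to
  either side.\<close>

lemma soft_count:
  fixes w z :: "'p \<Rightarrow> real" and \<eta> \<delta> :: real
  assumes "finite P" "0 < \<eta>" "0 < \<delta>" "\<eta> * card P \<le> \<delta>" "A \<subseteq> S" "S \<subseteq> P"
    and w: "\<And>p. 0 \<le> w p" "\<And>p. w p \<le> 1"
    and bad: "card {p \<in> P. w p \<noteq> of_bool (p \<in> S)} \<le> k" and strip: "card {p \<in> P. \<bar>z p\<bar> \<le> \<delta>} \<le> 3"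
    and zA: "\<And>p. p \<in> S \<Longrightarrow> 0 < z p \<Longrightarrow> p \<in> A" "\<And>p. p \<in> A \<Longrightarrow> 0 \<le> z p"
  shows "\<bar>(\<Sum>p\<in>P. w p * soft_sgn \<eta> (z p)) - (real (card A) - real (card (S - A)))\<bar> \<le> real k + 7"
proof -
  define s :: "'p \<Rightarrow> real" where "s p = (if p \<in> A then 1 else -1)" for p
  have "real (card A) - real (card (S - A)) = (\<Sum>p\<in>A. s p) + (\<Sum>p\<in>S-A. s p)"
    by (simp add: s_def)
  also have "\<dots> = (\<Sum>p\<in>S. s p)"
    using sum.subset_diff[OF \<open>A \<subseteq> S\<close>, of s] finite_subset[OF \<open>S \<subseteq> P\<close> \<open>finite P\<close>] by simp
  also have "\<dots> = (\<Sum>p\<in>P. of_bool (p \<in> S) * s p)"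
    using assms(1,6) by (intro sum.mono_neutral_cong_left) auto
  finally have "(\<Sum>p\<in>P. w p * soft_sgn \<eta> (z p)) - (real (card A) - real (card (S - A)))
      = (\<Sum>p\<in>P. w p * soft_sgn \<eta> (z p) - of_bool (p \<in> S) * s p)"
    by (simp add: sum_subtractf)
  also have "\<bar>\<dots>\<bar> \<le> (\<Sum>p\<in>P. of_bool (w p \<noteq> of_bool (p \<in> S)) + (2 * of_bool (\<bar>z p\<bar> \<le> \<delta>) + \<eta> / \<delta>))"
  proof (rule order_trans[OF sum_abs sum_mono])
    fix p assume "p \<in> P"
    let ?t = "soft_sgn \<eta> (z p)"
    have t: "\<bar>?t\<bar> \<le> 1" using assms by (simp add: abs_soft_sgn_le)
    have ed: "0 \<le> \<eta> / \<delta>" using assms by simp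
    show "\<bar>w p * ?t - of_bool (p \<in> S) * s p\<bar> \<le> of_bool (w p \<noteq> of_bool (p \<in> S)) + (2 * of_bool (\<bar>z p\<bar> \<le> \<delta>) + \<eta> / \<delta>)"
    proof (cases "p \<in> S")
      case False
      have "\<bar>w p * ?t\<bar> \<le> of_bool (w p \<noteq> 0)"
        using w[of p] t by (auto simp: abs_mult mult_le_one)
      then show ?thesis using False ed by (cases "w p = 0") auto
    next
      case True
      have "\<bar>w p * ?t - ?t\<bar> \<le> of_bool (w p \<noteq> 1)"
      proof -
        have "\<bar>w p * ?t - ?t\<bar> = \<bar>w p - 1\<bar> * \<bar>?t\<bar>"
          by (simp add: abs_mult[symmetric] algebra_simps)
        also have "\<dots> \<le> of_bool (w p \<noteq> 1)"
          using w[of p] t by (auto intro!: mult_le_one)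
        finally show ?thesis .
      qed
      moreover have "\<bar>?t - s p\<bar> \<le> 2 * of_bool (\<bar>z p\<bar> \<le> \<delta>) + \<eta> / \<delta>"
      proof (cases "\<bar>z p\<bar> \<le> \<delta>")
        case True
        have "\<bar>s p\<bar> = 1" by (simp add: s_def)
        then have "\<bar>?t - s p\<bar> \<le> 2" using t by linarith
        then show ?thesis using True ed by simp
      next
        case False
        then have "s p = sgn (z p)"
          using zA[of p] \<open>p \<in> S\<close> assms(3) by (cases "p \<in> A") (auto simp: s_def sgn_if)
        then show ?thesis
          using soft_sgn_near_sgn[of \<eta> \<delta> "z p"] False assms(2,3) by simp
      qed
      ultimately show ?thesis using True by simp
    qed
  qed
  also have "\<dots> = card {p \<in> P. w p \<noteq> of_bool (p \<in> S)} + (2 * card {p \<in> P. \<bar>z p\<bar> \<le> \<delta>} + card P * (\<eta> / \<delta>))"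
    using assms(1) by (simp add: sum.distrib sum_distrib_left[symmetric] Int_def)
  also have "\<dots> \<le> real k + (2 * 3 + 1)"
  proof -
    have "card P * (\<eta> / \<delta>) \<le> 1" using assms(3,4) by (simp add: field_simps)
    moreover have "real (card {p \<in> P. \<bar>z p\<bar> \<le> \<delta>}) \<le> 3" using strip by simp
    ultimately show ?thesis using bad by linarith
  qed
  finally show ?thesis by simp
qed

text \<open>A continuous substitute for the indicator of a half-line. Weights built from it describe
  strips that vary continuously with the direction.\<close>

definition ramp :: "real \<Rightarrow> real \<Rightarrow> real" where
  "ramp \<delta> z = max 0 (min 1 (z / \<delta>))"

lemma ramp_bounds: "0 \<le> ramp \<delta> z" "ramp \<delta> z \<le> 1"
  by (auto simp: ramp_def)

lemma ramp_eq_1: "0 < \<delta> \<Longrightarrow> \<delta> \<le> z \<Longrightarrow> ramp \<delta> z = 1"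
  by (simp add: ramp_def)

lemma ramp_pos_iff: "0 < \<delta> \<Longrightarrow> 0 < ramp \<delta> z \<longleftrightarrow> 0 < z"
  by (auto simp: ramp_def less_max_iff_disj zero_less_divide_iff)

lemma ramp_eq_0: "0 < \<delta> \<Longrightarrow> z \<le> 0 \<Longrightarrow> ramp \<delta> z = 0"
  by (simp add: ramp_def divide_nonpos_pos)

lemma continuous_on_ramp [continuous_intros]:
  "0 < \<delta> \<Longrightarrow> continuous_on A f \<Longrightarrow> continuous_on A (\<lambda>t. ramp \<delta> (f t))"
  unfolding ramp_def by (intro continuous_intros) auto

text \<open>The functions \<open>x \<theta>\<close> and \<open>y \<theta>\<close> are the coordinates in the frame rotated by \<open>\<theta>\<close>. The number \<open>\<delta>\<close> is so
  small that at most three points of \<open>P\<close> are near any given line.\<close>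

locale sweep =
  fixes P :: "'p set" and x y :: "real \<Rightarrow> 'p \<Rightarrow> real" and \<delta> \<eta> :: real
  assumes finP: "finite P" and \<delta>: "0 < \<delta>" and \<eta>: "0 < \<eta>" "\<eta> * card P \<le> \<delta>" and large: "100 \<le> card P"
    and contx: "\<And>p. continuous_on UNIV (\<lambda>\<theta>. x \<theta> p)" and conty: "\<And>p. continuous_on UNIV (\<lambda>\<theta>. y \<theta> p)"
    and antix: "\<And>\<theta> p. x (\<theta> + pi) p = - x \<theta> p" and antiy: "\<And>\<theta> p. y (\<theta> + pi) p = - y \<theta> p"
    and stripx: "\<And>\<theta> s. card {p \<in> P. \<bar>s - x \<theta> p\<bar> \<le> \<delta>} \<le> 3"
    and stripl: "\<And>\<theta> a b. card {p \<in> P. \<bar>a * x \<theta> p + b - y \<theta> p\<bar> \<le> \<delta>} \<le> 3"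
begin

definition below :: "real \<Rightarrow> real \<Rightarrow> real \<Rightarrow> 'p set" where
  "below \<theta> a b = {p. y \<theta> p \<le> a * x \<theta> p + b}"

section \<open>Cuts that depend continuously on the direction\<close>

lemma continuous_x [continuous_intros]:
  "continuous_on A f \<Longrightarrow> continuous_on A (\<lambda>t. x (f t) p)"
  using continuous_on_compose2[OF contx] by blast

lemma continuous_y [continuous_intros]:
  "continuous_on A f \<Longrightarrow> continuous_on A (\<lambda>t. y (f t) p)"
  using continuous_on_compose2[OF conty] by blast

text \<open>The cut \<open>\<sigma> \<theta>\<close> is the root of the equation saying that left
  minus right is \<open>- card P / 3\<close>, so about a third of \<open>P\<close> lies to the left.
  The difference is off by at most 7, the count itself by half of that. Two half turns restore the
  coordinates and hence the root.\<close>

lemma exists_third: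
  obtains \<sigma> where "continuous_on UNIV \<sigma>" "\<And>\<theta>. \<sigma> (\<theta> + pi + pi) = \<sigma> \<theta>"
    "\<And>\<theta>. \<bar>card {p \<in> P. x \<theta> p < \<sigma> \<theta>} - card P / 3\<bar> \<le> 7 / 2"
proof -
  define F where "F \<theta> s = (\<Sum>p\<in>P. soft_sgn \<eta> (s - x \<theta> p)) + card P / 3" for \<theta> s
  have P0: "P \<noteq> {}" using large by auto
  have mono: "F \<theta> s < F \<theta> t" if "s < t" for \<theta> s t
    unfolding F_def using finP P0 \<eta> that
    by (intro add_strict_right_mono sum_strict_mono soft_sgn_strict_mono) auto
  define R where "R \<theta> = (\<Sum>p\<in>P. \<bar>x \<theta> p\<bar>)" for \<theta>
  have R0: "\<bar>x \<theta> p\<bar> \<le> R \<theta>" if "p \<in> P" for \<theta> p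
    unfolding R_def using finP that by (intro member_le_sum) auto
  have R: "- R \<theta> \<le> x \<theta> p" "x \<theta> p \<le> R \<theta>" if "p \<in> P" for \<theta> p
    using R0[OF that, of \<theta>] by linarith+
  \<comment> \<open>The extra shift by \<open>\<eta>\<close> pushes every soft sign down to at most
    \<open>- 1 / 2\<close>, which outweighs the added \<open>1 / 3\<close> per point.\<close>
  have neg: "F \<theta> (- R \<theta> - \<eta>) \<le> 0" for \<theta>
  proof -
    have "(\<Sum>p\<in>P. soft_sgn \<eta> (- R \<theta> - \<eta> - x \<theta> p)) \<le> (\<Sum>p\<in>P. soft_sgn \<eta> (- \<eta>))"
      using R[of _ \<theta>] \<eta> by (intro sum_mono soft_sgn_mono) auto
    also have "soft_sgn \<eta> (- \<eta>) = - 1 / 2" using \<eta> by (simp add: soft_sgn_def)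
    finally show ?thesis by (simp add: F_def)
  qed
  have pos: "0 \<le> F \<theta> (R \<theta>)" for \<theta>
  proof -
    have "(\<Sum>p\<in>P. soft_sgn \<eta> 0) \<le> (\<Sum>p\<in>P. soft_sgn \<eta> (R \<theta> - x \<theta> p))"
      using R[of _ \<theta>] \<eta> by (intro sum_mono soft_sgn_mono) auto
    then show ?thesis by (simp add: F_def soft_sgn_def)
  qed
  obtain \<sigma> where \<sigma>: "continuous_on UNIV \<sigma>" "\<And>\<theta> s. F \<theta> s = 0 \<longleftrightarrow> s = \<sigma> \<theta>"
  proof (rule continuous_root[of F])
    show "continuous_on UNIV (\<lambda>\<theta>. F \<theta> s)" "continuous_on UNIV (F \<theta>)" for s \<theta>
      unfolding F_def using \<eta> by (intro continuous_intros; simp)+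
  qed (use mono neg pos in blast)+
  show ?thesis
  proof
    have "F (\<theta> + pi + pi) s = F \<theta> s" for \<theta> s unfolding F_def antix by simp
    then show "\<sigma> (\<theta> + pi + pi) = \<sigma> \<theta>" for \<theta>
      using \<sigma>(2)[of "\<theta> + pi + pi" "\<sigma> \<theta>"] \<sigma>(2)[of \<theta> "\<sigma> \<theta>"] by simp
    show "\<bar>card {p \<in> P. x \<theta> p < \<sigma> \<theta>} - card P / 3\<bar> \<le> 7 / 2" for \<theta>
    proof -
      let ?A = "{p \<in> P. x \<theta> p < \<sigma> \<theta>}"
      have "\<bar>(\<Sum>p\<in>P. 1 * soft_sgn \<eta> (\<sigma> \<theta> - x \<theta> p)) - (real (card ?A) - real (card (P - ?A)))\<bar> \<le> real 0 + 7"
        using finP \<eta> \<delta> stripx by (intro soft_count[of P \<eta> \<delta>]) auto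
      moreover have "(\<Sum>p\<in>P. soft_sgn \<eta> (\<sigma> \<theta> - x \<theta> p)) + card P / 3 = 0"
        using \<sigma>(2)[of \<theta> "\<sigma> \<theta>"] by (simp add: F_def)
      moreover have "real (card (P - ?A)) = real (card P) - real (card ?A)"
        using finP by (subst card_Diff_subset) (auto simp: of_nat_diff card_mono)
      ultimately show ?thesis unfolding mult_1 of_nat_0 by linarith
    qed
  qed (use \<sigma> in auto)
qed

lemma card_half:
  assumes bal: "(\<Sum>p\<in>P. w p * soft_sgn \<eta> (a * x \<theta> p + b - y \<theta> p)) = 0" and "S \<subseteq> P"
    and w: "\<And>p. 0 \<le> w p" "\<And>p. w p \<le> 1" and bad: "card {p \<in> P. w p \<noteq> of_bool (p \<in> S)} \<le> k"
  shows "\<bar>2 * real (card (S \<inter> below \<theta> a b)) - card S\<bar> \<le> real k + 7"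
    and "\<bar>2 * real (card (S - below \<theta> a b)) - card S\<bar> \<le> real k + 7"
proof -
  have finS: "finite S" using finP assms(2) finite_subset by blast
  have "S - S \<inter> below \<theta> a b = S - below \<theta> a b" by auto
  then have "\<bar>(\<Sum>p\<in>P. w p * soft_sgn \<eta> (a * x \<theta> p + b - y \<theta> p))
      - (real (card (S \<inter> below \<theta> a b)) - real (card (S - below \<theta> a b)))\<bar> \<le> real k + 7"
    using soft_count[OF finP \<eta>(1) \<delta> \<eta>(2) _ assms(2) w bad stripl, of "S \<inter> below \<theta> a b" a \<theta> b]
    by (simp add: below_def)
  moreover have "real (card S) = card (S \<inter> below \<theta> a b) + card (S - below \<theta> a b)"
    unfolding of_nat_add[symmetric] of_nat_eq_iff by (rule card_Int_Diff[OF finS])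
  ultimately have "2 * real (card (S \<inter> below \<theta> a b)) \<le> card S + real k + 7"
      "card S - real k - 7 \<le> 2 * real (card (S \<inter> below \<theta> a b))"
      "real (card (S - below \<theta> a b)) = card S - real (card (S \<inter> below \<theta> a b))"
    unfolding bal of_nat_add by (auto simp: abs_le_iff)
  note bounds = this
  show "\<bar>2 * real (card (S \<inter> below \<theta> a b)) - card S\<bar> \<le> real k + 7"
    using bounds by linarith
  show "\<bar>2 * real (card (S - below \<theta> a b)) - card S\<bar> \<le> real k + 7"
    using bounds by linarith
qed

text \<open>\<open>\<beta> \<theta> a\<close> is the intercept of the line of slope \<open>a\<close>
  that halves the weighted points. For the last claim, the line of slope \<open>a + h\<close> with
  intercept \<open>\<beta> \<theta> a - h * u \<theta>\<close> does not exceed the old line at any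
  point with \<open>x \<theta> p \<le> u \<theta>\<close>, so its intercept is at most the halving
  one.\<close>

lemma exists_halving:
  assumes contw: "\<And>p. continuous_on UNIV (\<lambda>\<theta>. w \<theta> p)" and w: "\<And>\<theta> p. 0 \<le> w \<theta> p"
    and wpos: "\<And>\<theta>. \<exists>p\<in>P. 0 < w \<theta> p" and per: "\<And>\<theta> p. w (\<theta> + pi + pi) p = w \<theta> p"
    and supp: "\<And>\<theta> p. p \<in> P \<Longrightarrow> 0 < w \<theta> p \<Longrightarrow> x \<theta> p \<le> u \<theta>"
  obtains \<beta> where "continuous_on UNIV (\<lambda>(\<theta>, a). \<beta> \<theta> a)" "\<And>\<theta> a. \<beta> (\<theta> + pi + pi) a = \<beta> \<theta> a"
    "\<And>\<theta> a. (\<Sum>p\<in>P. w \<theta> p * soft_sgn \<eta> (a * x \<theta> p + \<beta> \<theta> a - y \<theta> p)) = 0"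
    "\<And>\<theta> a h. 0 \<le> h \<Longrightarrow> \<beta> \<theta> a - h * u \<theta> \<le> \<beta> \<theta> (a + h)"
proof -
  define F where "F = (\<lambda>(\<theta>, a) b. \<Sum>p\<in>P. w \<theta> p * soft_sgn \<eta> (a * x \<theta> p + b - y \<theta> p))"
  have mono: "F v s < F v t" if "s < t" for v s t
  proof -
    obtain \<theta> a where v: "v = (\<theta>, a)" by force
    obtain p where p: "p \<in> P" "0 < w \<theta> p" using wpos by blast
    have lt: "soft_sgn \<eta> (a * x \<theta> p + s - y \<theta> p) < soft_sgn \<eta> (a * x \<theta> p + t - y \<theta> p)" for p
      using that \<eta> by (intro soft_sgn_strict_mono) auto
    show ?thesis
      unfolding F_def v prod.case
    proof (rule sum_strict_mono_ex1[OF finP])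
      show "\<forall>p\<in>P. w \<theta> p * soft_sgn \<eta> (a * x \<theta> p + s - y \<theta> p) \<le> w \<theta> p * soft_sgn \<eta> (a * x \<theta> p + t - y \<theta> p)"
        by (intro ballI mult_left_mono less_imp_le[OF lt] w)
      show "\<exists>p\<in>P. w \<theta> p * soft_sgn \<eta> (a * x \<theta> p + s - y \<theta> p) < w \<theta> p * soft_sgn \<eta> (a * x \<theta> p + t - y \<theta> p)"
        using p lt by (intro bexI[of _ p]) auto
    qed
  qed
  define R where "R = (\<lambda>(\<theta>, a). \<Sum>p\<in>P. \<bar>a * x \<theta> p - y \<theta> p\<bar>)"
  have R: "\<bar>a * x \<theta> p - y \<theta> p\<bar> \<le> R (\<theta>, a)" if "p \<in> P" for \<theta> a p
    unfolding R_def prod.case using finP that by (intro member_le_sum) auto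
  have sgn0: "soft_sgn \<eta> 0 = 0" by (simp add: soft_sgn_def)
  have neg: "F v (- R v) \<le> 0" for v
  proof -
    obtain \<theta> a where v: "v = (\<theta>, a)" by force
    have "soft_sgn \<eta> (a * x \<theta> p + (- R v) - y \<theta> p) \<le> 0" if "p \<in> P" for p
      using soft_sgn_mono[of \<eta> "a * x \<theta> p + (- R v) - y \<theta> p" 0] R[OF that, of a \<theta>] \<eta> sgn0 v by auto
    then show ?thesis
      unfolding F_def v prod.case using w v by (intro sum_nonpos mult_nonneg_nonpos) auto
  qed
  have pos: "0 \<le> F v (R v)" for v
  proof -
    obtain \<theta> a where v: "v = (\<theta>, a)" by force
    have "0 \<le> soft_sgn \<eta> (a * x \<theta> p + R v - y \<theta> p)" if "p \<in> P" for p
      using soft_sgn_mono[of \<eta> 0 "a * x \<theta> p + R v - y \<theta> p"] R[OF that, of a \<theta>] \<eta> sgn0 v by auto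
    then show ?thesis
      unfolding F_def v prod.case using w v by (intro sum_nonneg mult_nonneg_nonneg) auto
  qed
  have cw: "continuous_on A (\<lambda>v. w (f v) p)" if "continuous_on A f" for A and f :: "real \<times> real \<Rightarrow> real" and p
    using continuous_on_compose2[OF contw that] by blast
  have cont1: "continuous_on UNIV (\<lambda>v. F v t)" for t
    unfolding F_def case_prod_beta using \<eta> by (intro continuous_intros cw) auto
  have cont2: "continuous_on UNIV (F v)" for v
    unfolding F_def case_prod_beta using \<eta> by (intro continuous_intros) auto
  obtain g where g: "continuous_on UNIV g" "\<And>v t. F v t = 0 \<longleftrightarrow> t = g v" "\<And>v t. F v t \<le> 0 \<longleftrightarrow> t \<le> g v"
    by (rule continuous_root[of F, OF cont1 cont2 mono]) (use neg pos in blast)+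
  show ?thesis
  proof (rule that[of "\<lambda>\<theta> a. g (\<theta>, a)"])
    show "continuous_on UNIV (\<lambda>(\<theta>, a). g (\<theta>, a))" using g(1) by simp
    have "F (\<theta> + pi + pi, a) t = F (\<theta>, a) t" for \<theta> a t
      unfolding F_def prod.case antix antiy per by simp
    then show "g (\<theta> + pi + pi, a) = g (\<theta>, a)" for \<theta> a
      using g(2)[of "(\<theta> + pi + pi, a)" "g (\<theta>, a)"] g(2)[of "(\<theta>, a)" "g (\<theta>, a)"] by simp
    show bal: "(\<Sum>p\<in>P. w \<theta> p * soft_sgn \<eta> (a * x \<theta> p + g (\<theta>, a) - y \<theta> p)) = 0" for \<theta> a
      using g(2)[of "(\<theta>, a)" "g (\<theta>, a)"] by (simp add: F_def)
    show "g (\<theta>, a) - h * u \<theta> \<le> g (\<theta>, a + h)" if "0 \<le> h" for \<theta> a h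
    proof -
      have "F (\<theta>, a + h) (g (\<theta>, a) - h * u \<theta>)
          \<le> (\<Sum>p\<in>P. w \<theta> p * soft_sgn \<eta> (a * x \<theta> p + g (\<theta>, a) - y \<theta> p))"
        unfolding F_def prod.case
      proof (rule sum_mono)
        fix p assume p: "p \<in> P"
        show "w \<theta> p * soft_sgn \<eta> ((a + h) * x \<theta> p + (g (\<theta>, a) - h * u \<theta>) - y \<theta> p)
            \<le> w \<theta> p * soft_sgn \<eta> (a * x \<theta> p + g (\<theta>, a) - y \<theta> p)"
        proof (cases "w \<theta> p = 0")
          case False
          then have "x \<theta> p \<le> u \<theta>" using supp[OF p] w[of \<theta> p] by simp
          then have "h * x \<theta> p \<le> h * u \<theta>" using that by (rule mult_left_mono)
          then show ?thesis
            using w \<eta> by (intro mult_left_mono soft_sgn_mono) (auto simp: algebra_simps)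
        qed simp
      qed
      then show ?thesis using bal[of \<theta> a] g(3) by simp
    qed
  qed
qed

text \<open>Rotation by \<open>\<pi>\<close> exchanges the two outer strips and both sides of the line that halves them. Hence
  the imbalance \<open>G\<close> of the middle strip changes its sign, and some direction balances all three strips.\<close>

lemma exists_six_parts:
  obtains \<theta> s t a b where "s < t"
    "\<And>S. S \<in> {{p \<in> P. x \<theta> p < s}, {p \<in> P. s \<le> x \<theta> p \<and> x \<theta> p \<le> t}, {p \<in> P. t < x \<theta> p}} \<Longrightarrow>
      \<bar>card (S \<inter> below \<theta> a b) - card P / 6\<bar> \<le> 10 \<and> \<bar>card (S - below \<theta> a b) - card P / 6\<bar> \<le> 10"
proof -
  obtain \<sigma> where cont\<sigma>: "continuous_on UNIV \<sigma>" and per\<sigma>: "\<And>\<theta>. \<sigma> (\<theta> + pi + pi) = \<sigma> \<theta>"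
    and \<sigma>: "\<And>\<theta>. \<bar>card {p \<in> P. x \<theta> p < \<sigma> \<theta>} - card P / 3\<bar> \<le> 7 / 2"
    by (rule exists_third) blast
  have largeR: "100 \<le> real (card P)" using large by simp
  have c\<sigma>: "continuous_on A (\<lambda>t. \<sigma> (f t))" if "continuous_on A f" for A :: "'z::topological_space set" and f
    using continuous_on_compose2[OF cont\<sigma> that] by blast
  \<comment> \<open>A half turn reverses \<open>x\<close>, so
    \<open>- \<sigma> (\<theta> + pi)\<close> cuts off the right third in the frame of
    \<open>\<theta>\<close>.\<close>
  have \<sigma>': "\<bar>card {p \<in> P. - \<sigma> (\<theta> + pi) < x \<theta> p} - card P / 3\<bar> \<le> 7 / 2" for \<theta>
    using \<sigma>[of "\<theta> + pi"] by (simp add: antix minus_less_iff)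
  define M where "M \<theta> = {p \<in> P. \<sigma> \<theta> \<le> x \<theta> p \<and> x \<theta> p \<le> - \<sigma> (\<theta> + pi)}" for \<theta>
  have cover: "card P \<le> card {p \<in> P. x \<theta> p < \<sigma> \<theta>} + card (M \<theta>) + card {p \<in> P. - \<sigma> (\<theta> + pi) < x \<theta> p}" for \<theta>
  proof -
    have "card P = card ({p \<in> P. x \<theta> p < \<sigma> \<theta>} \<union> M \<theta> \<union> {p \<in> P. - \<sigma> (\<theta> + pi) < x \<theta> p})"
      by (intro arg_cong[of _ _ card]) (auto simp: M_def)
    also have "\<dots> \<le> card ({p \<in> P. x \<theta> p < \<sigma> \<theta>} \<union> M \<theta>) + card {p \<in> P. - \<sigma> (\<theta> + pi) < x \<theta> p}"
      by (rule card_Un_le)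
    also have "card ({p \<in> P. x \<theta> p < \<sigma> \<theta>} \<union> M \<theta>) \<le> card {p \<in> P. x \<theta> p < \<sigma> \<theta>} + card (M \<theta>)"
      by (rule card_Un_le)
    finally show ?thesis by simp
  qed
  \<comment> \<open>Otherwise the middle third would fit into a strip of width
    \<open>2 * \<delta>\<close> and have at most three points.\<close>
  have sep: "\<sigma> \<theta> + 2 * \<delta> < - \<sigma> (\<theta> + pi)" for \<theta>
  proof (rule ccontr)
    assume "\<not> ?thesis"
    then have "M \<theta> \<subseteq> {p \<in> P. \<bar>(\<sigma> \<theta> + \<delta>) - x \<theta> p\<bar> \<le> \<delta>}"
      by (auto simp: M_def abs_le_iff)
    then have "card (M \<theta>) \<le> card {p \<in> P. \<bar>(\<sigma> \<theta> + \<delta>) - x \<theta> p\<bar> \<le> \<delta>}"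
      using finP by (intro card_mono) auto
    then have "real (card (M \<theta>)) \<le> 3" using stripx[of "\<sigma> \<theta> + \<delta>" \<theta>] by linarith
    moreover have "real (card P) \<le> card {p \<in> P. x \<theta> p < \<sigma> \<theta>} + real (card (M \<theta>))
        + card {p \<in> P. - \<sigma> (\<theta> + pi) < x \<theta> p}"
      using cover[of \<theta>] by linarith
    ultimately show False
      using \<sigma>[of \<theta>] \<sigma>'[of \<theta>] largeR by linarith
  qed
  \<comment> \<open>A soft indicator of the left strip; \<open>w (\<theta> + pi)\<close> is then one
    of the right strip.\<close>
  define w where "w \<theta> p = ramp \<delta> (\<sigma> \<theta> + \<delta> - x \<theta> p)" for \<theta> p
  have wP: "\<exists>p\<in>P. 0 < w \<theta> p" for \<theta>
  proof -
    have "card {p \<in> P. x \<theta> p < \<sigma> \<theta>} \<noteq> 0"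
      using \<sigma>[of \<theta>] largeR by linarith
    then have "{p \<in> P. x \<theta> p < \<sigma> \<theta>} \<noteq> {}"
      by (metis card.empty)
    then obtain p where "p \<in> P" "x \<theta> p < \<sigma> \<theta>" by blast
    then show ?thesis using \<delta> by (intro bexI[of _ p]) (auto simp: w_def ramp_pos_iff)
  qed
  obtain \<beta> where cont\<beta>: "continuous_on UNIV (\<lambda>(\<theta>, a). \<beta> \<theta> a)"
    and per\<beta>: "\<And>\<theta> a. \<beta> (\<theta> + pi + pi) a = \<beta> \<theta> a"
    and bal: "\<And>\<theta> a. (\<Sum>p\<in>P. w \<theta> p * soft_sgn \<eta> (a * x \<theta> p + \<beta> \<theta> a - y \<theta> p)) = 0"
    and slope: "\<And>\<theta> a h. 0 \<le> h \<Longrightarrow> \<beta> \<theta> a - h * (\<sigma> \<theta> + \<delta>) \<le> \<beta> \<theta> (a + h)"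
  proof (rule exists_halving[of w "\<lambda>\<theta>. \<sigma> \<theta> + \<delta>"])
    show "continuous_on UNIV (\<lambda>\<theta>. w \<theta> p)" for p
      unfolding w_def using \<delta> by (intro continuous_intros cont\<sigma>)
    show "w (\<theta> + pi + pi) p = w \<theta> p" for \<theta> p
      unfolding w_def per\<sigma> antix by simp
    show "x \<theta> p \<le> \<sigma> \<theta> + \<delta>" if "0 < w \<theta> p" for \<theta> p
      using that \<delta> by (simp add: w_def ramp_pos_iff)
  qed (use wP in \<open>auto simp: w_def ramp_bounds\<close>)
  have c\<beta>: "continuous_on A (\<lambda>t. \<beta> (f t) (g t))" if "continuous_on A f" "continuous_on A g"
    for A :: "'z::topological_space set" and f g
    using continuous_on_compose2[OF cont\<beta> continuous_on_Pair[OF that]] by simp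
  \<comment> \<open>Back in the frame of \<open>\<theta>\<close>, the line of slope \<open>a\<close>
    that halves the right strip has intercept \<open>- \<beta> (\<theta> + pi) a\<close>. So
    \<open>F \<theta> a = 0\<close> says that one line of slope \<open>a\<close> halves both outer
    strips.\<close>
  define F where "F \<theta> a = \<beta> \<theta> a + \<beta> (\<theta> + pi) a" for \<theta> a
  define \<kappa> where "\<kappa> \<theta> = - \<sigma> (\<theta> + pi) - \<sigma> \<theta> - 2 * \<delta>" for \<theta>
  have \<kappa>: "0 < \<kappa> \<theta>" for \<theta> using sep[of \<theta>] by (simp add: \<kappa>_def)
  \<comment> \<open>The positive gap \<open>\<kappa> \<theta>\<close> between the supports of the
    two weights makes \<open>F\<close> grow at least linearly in the slope. This gives the sign
    changes and the uniqueness of the root.\<close>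
  have grow: "F \<theta> a + h * \<kappa> \<theta> \<le> F \<theta> (a + h)" if "0 \<le> h" for \<theta> a h
    using slope[OF that, of \<theta> a] slope[OF that, of "\<theta> + pi" a]
    by (simp add: F_def \<kappa>_def algebra_simps)
  have mono: "F \<theta> s < F \<theta> t" if "s < t" for \<theta> s t
  proof -
    have "0 < (t - s) * \<kappa> \<theta>" using that \<kappa> by simp
    then show ?thesis using grow[of "t - s" \<theta> s] that by simp
  qed
  have pos: "\<exists>a. 0 \<le> F \<theta> a" for \<theta>
  proof
    show "0 \<le> F \<theta> (0 + \<bar>F \<theta> 0\<bar> / \<kappa> \<theta>)"
      using grow[of "\<bar>F \<theta> 0\<bar> / \<kappa> \<theta>" \<theta> 0] \<kappa>[of \<theta>] by simp
  qed
  have neg: "\<exists>a. F \<theta> a \<le> 0" for \<theta>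
  proof
    show "F \<theta> (- (\<bar>F \<theta> 0\<bar> / \<kappa> \<theta>)) \<le> 0"
      using grow[of "\<bar>F \<theta> 0\<bar> / \<kappa> \<theta>" \<theta> "- (\<bar>F \<theta> 0\<bar> / \<kappa> \<theta>)"] \<kappa>[of \<theta>] by simp
  qed
  obtain \<alpha> where cont\<alpha>: "continuous_on UNIV \<alpha>" and \<alpha>: "\<And>\<theta> a. F \<theta> a = 0 \<longleftrightarrow> a = \<alpha> \<theta>"
  proof (rule continuous_root[of F])
    show "continuous_on UNIV (\<lambda>\<theta>. F \<theta> a)" "continuous_on UNIV (F \<theta>)" for a \<theta>
      unfolding F_def by (intro continuous_intros c\<beta>)+
  qed (use mono neg pos in blast)+
  have anti\<beta>: "\<beta> (\<theta> + pi) (\<alpha> \<theta>) = - \<beta> \<theta> (\<alpha> \<theta>)" for \<theta>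
    using \<alpha>[of \<theta> "\<alpha> \<theta>"] by (simp add: F_def)
  have per\<alpha>: "\<alpha> (\<theta> + pi) = \<alpha> \<theta>" for \<theta>
  proof -
    have "F (\<theta> + pi) (\<alpha> \<theta>) = F \<theta> (\<alpha> \<theta>)" unfolding F_def per\<beta> by simp
    then show ?thesis using \<alpha>[of "\<theta> + pi" "\<alpha> \<theta>"] \<alpha>[of \<theta> "\<alpha> \<theta>"] by simp
  qed
  \<comment> \<open>A soft indicator of the middle strip. A half turn exchanges its two ramps, so it
    is the same at angles \<open>0\<close> and \<open>pi\<close>.\<close>
  define w' where "w' \<theta> p = min (ramp \<delta> (x \<theta> p - \<sigma> \<theta> + \<delta>)) (ramp \<delta> (- \<sigma> (\<theta> + pi) + \<delta> - x \<theta> p))" for \<theta> p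
  define G where "G \<theta> = (\<Sum>p\<in>P. w' \<theta> p * soft_sgn \<eta> (\<alpha> \<theta> * x \<theta> p + \<beta> \<theta> (\<alpha> \<theta>) - y \<theta> p))" for \<theta>
  have contG: "continuous_on UNIV G"
    unfolding G_def w'_def using \<eta> \<delta> by (intro continuous_intros c\<beta> c\<sigma> cont\<alpha> cont\<sigma>)
  have antiG: "G (0 + pi) = - G 0"
  proof -
    have w's: "w' (0 + pi) p = w' 0 p" for p
      using per\<sigma>[of 0] unfolding w'_def antix by (simp add: min.commute algebra_simps)
    have z: "\<alpha> (0 + pi) * x (0 + pi) p + \<beta> (0 + pi) (\<alpha> (0 + pi)) - y (0 + pi) p
        = - (\<alpha> 0 * x 0 p + \<beta> 0 (\<alpha> 0) - y 0 p)" for p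
      unfolding antix antiy per\<alpha> anti\<beta> by simp
    show ?thesis unfolding G_def w's z by (simp only: soft_sgn_minus mult_minus_right sum_negf)
  qed
  have "\<exists>\<theta>. G \<theta> = 0"
  proof (cases "G 0 \<le> 0")
    case True
    then show ?thesis
      using IVT'[of G 0 0 pi] antiG continuous_on_subset[OF contG] by auto
  next
    case False
    then show ?thesis
      using IVT2'[of G pi 0 0] antiG continuous_on_subset[OF contG] by auto
  qed
  then obtain \<theta> where G0: "G \<theta> = 0" by blast
  define s t a b where "s = \<sigma> \<theta>" and "t = - \<sigma> (\<theta> + pi)" and "a = \<alpha> \<theta>" and "b = \<beta> \<theta> (\<alpha> \<theta>)"
  note st_def = s_def t_def a_def b_def
  have st: "s < t" using sep[of \<theta>] \<delta> by (simp add: st_def)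
  define S1 S2 S3 where "S1 = {p \<in> P. x \<theta> p < s}" and "S2 = {p \<in> P. s \<le> x \<theta> p \<and> x \<theta> p \<le> t}"
    and "S3 = {p \<in> P. t < x \<theta> p}"
  note S_def = S1_def S2_def S3_def
  have c1: "\<bar>card S1 - card P / 3\<bar> \<le> 7 / 2" and c3: "\<bar>card S3 - card P / 3\<bar> \<le> 7 / 2"
    using \<sigma>[of \<theta>] \<sigma>'[of \<theta>] by (simp_all add: S_def st_def)
  have "card P = card (S1 \<union> S2 \<union> S3)"
    using st by (intro arg_cong[of _ _ card]) (auto simp: S_def)
  also have "\<dots> = card S1 + card S2 + card S3"
    using finP st by (subst card_Un_disjoint; (subst card_Un_disjoint)?) (auto simp: S_def)
  finally have "real (card P) = real (card S1) + real (card S2) + real (card S3)"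
    by simp
  then have c2: "\<bar>card S2 - card P / 3\<bar> \<le> 7"
    using c1 c3 by linarith
  have strip: "card {p \<in> P. \<bar>r - x \<theta> p\<bar> \<le> \<delta>} \<le> 3" for r
    by (rule stripx)
  have fin': "finite {p \<in> P. Q p}" for Q using finP by simp
  have sub: "{p \<in> P. f p \<noteq> g p} \<subseteq> {p \<in> P. Q p}" if "\<And>p. p \<in> P \<Longrightarrow> \<not> Q p \<Longrightarrow> f p = g p"
    for f g :: "'p \<Rightarrow> real" and Q
    using that by blast
  \<comment> \<open>Weight and indicator differ only within \<open>\<delta>\<close> of a boundary
    line. This allows three bad points for an outer strip and six for the middle one, which has two
    boundaries.\<close>
  have k1: "card {p \<in> P. w \<theta> p \<noteq> of_bool (p \<in> S1)} \<le> 3"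
  proof -
    have "w \<theta> p = of_bool (p \<in> S1)" if p: "p \<in> P" "\<delta> < \<bar>s - x \<theta> p\<bar>" for p
    proof (cases "x \<theta> p < s")
      case True
      then have "ramp \<delta> (s + \<delta> - x \<theta> p) = 1" using \<delta> by (intro ramp_eq_1) auto
      then show ?thesis using True p by (simp add: w_def S_def st_def)
    next
      case False
      then have "ramp \<delta> (s + \<delta> - x \<theta> p) = 0" using \<delta> p by (intro ramp_eq_0) auto
      then show ?thesis using False by (simp add: w_def S_def st_def)
    qed
    then have "{p \<in> P. w \<theta> p \<noteq> of_bool (p \<in> S1)} \<subseteq> {p \<in> P. \<bar>s - x \<theta> p\<bar> \<le> \<delta>}"
      by (intro sub) (simp add: not_le)
    then show ?thesis using le_trans[OF card_mono[OF fin'] strip[of s]] by simp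
  qed
  have w3: "w (\<theta> + pi) p = ramp \<delta> (x \<theta> p - t + \<delta>)" for p
    unfolding w_def t_def antix by (rule arg_cong[of _ _ "ramp \<delta>"]) linarith
  have k3: "card {p \<in> P. w (\<theta> + pi) p \<noteq> of_bool (p \<in> S3)} \<le> 3"
  proof -
    have "w (\<theta> + pi) p = of_bool (p \<in> S3)" if p: "p \<in> P" "\<delta> < \<bar>t - x \<theta> p\<bar>" for p
    proof (cases "t < x \<theta> p")
      case True
      then have "ramp \<delta> (x \<theta> p - t + \<delta>) = 1" using \<delta> by (intro ramp_eq_1) auto
      then show ?thesis using True p by (simp add: w3 S3_def)
    next
      case False
      then have "ramp \<delta> (x \<theta> p - t + \<delta>) = 0" using \<delta> p by (intro ramp_eq_0) auto
      then show ?thesis using False by (simp add: w3 S3_def)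
    qed
    then have "{p \<in> P. w (\<theta> + pi) p \<noteq> of_bool (p \<in> S3)} \<subseteq> {p \<in> P. \<bar>t - x \<theta> p\<bar> \<le> \<delta>}"
      by (intro sub) (simp add: not_le)
    then show ?thesis using le_trans[OF card_mono[OF fin'] strip[of t]] by simp
  qed
  have k2: "card {p \<in> P. w' \<theta> p \<noteq> of_bool (p \<in> S2)} \<le> 6"
  proof -
    have "w' \<theta> p = of_bool (p \<in> S2)" if p: "p \<in> P" "\<delta> < \<bar>s - x \<theta> p\<bar>" "\<delta> < \<bar>t - x \<theta> p\<bar>" for p
    proof -
      consider "x \<theta> p \<le> s - \<delta>" | "s + \<delta> \<le> x \<theta> p" "x \<theta> p \<le> t - \<delta>" | "t + \<delta> \<le> x \<theta> p"
        using p by linarith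
      then show ?thesis
      proof cases
        case 1
        then have "ramp \<delta> (x \<theta> p - s + \<delta>) = 0" "p \<notin> S2"
          using \<delta> by (auto simp: S_def intro!: ramp_eq_0)
        then show ?thesis by (simp add: w'_def st_def ramp_bounds min_absorb1)
      next
        case 2
        then have "ramp \<delta> (x \<theta> p - s + \<delta>) = 1" "ramp \<delta> (t + \<delta> - x \<theta> p) = 1" "p \<in> S2"
          using \<delta> p by (auto simp: S_def intro!: ramp_eq_1)
        then show ?thesis by (simp add: w'_def st_def)
      next
        case 3
        then have "ramp \<delta> (t + \<delta> - x \<theta> p) = 0" "p \<notin> S2"
          using \<delta> by (auto simp: S_def intro!: ramp_eq_0)
        then show ?thesis by (simp add: w'_def st_def ramp_bounds min_absorb2)
      qed
    qed
    then have "{p \<in> P. w' \<theta> p \<noteq> of_bool (p \<in> S2)}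
        \<subseteq> {p \<in> P. \<bar>s - x \<theta> p\<bar> \<le> \<delta> \<or> \<bar>t - x \<theta> p\<bar> \<le> \<delta>}"
      by (intro sub) (simp add: not_le)
    also have "\<dots> = {p \<in> P. \<bar>s - x \<theta> p\<bar> \<le> \<delta>} \<union> {p \<in> P. \<bar>t - x \<theta> p\<bar> \<le> \<delta>}"
      by blast
    finally have "card {p \<in> P. w' \<theta> p \<noteq> of_bool (p \<in> S2)}
        \<le> card ({p \<in> P. \<bar>s - x \<theta> p\<bar> \<le> \<delta>} \<union> {p \<in> P. \<bar>t - x \<theta> p\<bar> \<le> \<delta>})"
      using finP by (intro card_mono) auto
    also have "\<dots> \<le> card {p \<in> P. \<bar>s - x \<theta> p\<bar> \<le> \<delta>} + card {p \<in> P. \<bar>t - x \<theta> p\<bar> \<le> \<delta>}"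
      by (rule card_Un_le)
    finally show ?thesis using strip[of s] strip[of t] by linarith
  qed
  have b1: "(\<Sum>p\<in>P. w \<theta> p * soft_sgn \<eta> (a * x \<theta> p + b - y \<theta> p)) = 0"
    using bal[of \<theta> a] by (simp add: st_def)
  have b2: "(\<Sum>p\<in>P. w' \<theta> p * soft_sgn \<eta> (a * x \<theta> p + b - y \<theta> p)) = 0"
    using G0 by (simp add: st_def G_def)
  have b3: "(\<Sum>p\<in>P. w (\<theta> + pi) p * soft_sgn \<eta> (a * x \<theta> p + b - y \<theta> p)) = 0"
  proof -
    have z: "a * x (\<theta> + pi) p + \<beta> (\<theta> + pi) a - y (\<theta> + pi) p = - (a * x \<theta> p + b - y \<theta> p)" for p
      by (simp add: st_def antix antiy anti\<beta>)
    show ?thesis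
      using bal[of "\<theta> + pi" a] unfolding z by (simp only: soft_sgn_minus mult_minus_right sum_negf neg_equal_0_iff_equal)
  qed
  have "S1 \<subseteq> P" "S2 \<subseteq> P" "S3 \<subseteq> P" by (auto simp: S_def)
  note half = card_half[OF b1 \<open>S1 \<subseteq> P\<close> _ _ k1] card_half[OF b2 \<open>S2 \<subseteq> P\<close> _ _ k2] card_half[OF b3 \<open>S3 \<subseteq> P\<close> _ _ k3]
  have w01: "0 \<le> w \<phi> p" "w \<phi> p \<le> 1" "0 \<le> w' \<phi> p" "w' \<phi> p \<le> 1" for \<phi> p
    by (auto simp: w_def w'_def ramp_bounds min_le_iff_disj)
  \<comment> \<open>The middle strip is the tight case: its size is off by at most 7 and its halving
    by at most \<open>6 + 7\<close>, so each half is off by at most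
    \<open>(7 + 13) / 2 = 10\<close>.\<close>
  have "\<bar>card (S \<inter> below \<theta> a b) - card P / 6\<bar> \<le> 10 \<and> \<bar>card (S - below \<theta> a b) - card P / 6\<bar> \<le> 10"
    if "S \<in> {S1, S2, S3}" for S
    using that
  proof (elim insertE emptyE)
    assume "S = S1"
    show ?thesis unfolding \<open>S = S1\<close>
      using half(1,2)[OF w01(1,2), unfolded of_nat_numeral] c1 by (intro conjI) linarith+
  next
    assume "S = S2"
    show ?thesis unfolding \<open>S = S2\<close>
      using half(3,4)[OF w01(3,4), unfolded of_nat_numeral] c2 by (intro conjI) linarith+
  next
    assume "S = S3"
    show ?thesis unfolding \<open>S = S3\<close>
      using half(5,6)[OF w01(1,2), unfolded of_nat_numeral] c3 by (intro conjI) linarith+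
  qed
  then show ?thesis
    by (intro that[of s t \<theta> a b, OF st]) (auto simp: S_def)
qed

end

subsection \<open>Point sets without four collinear points\<close>

definition rot_x :: "real \<Rightarrow> real^2 \<Rightarrow> real" where
  "rot_x \<theta> p = cos \<theta> * p $ 1 + sin \<theta> * p $ 2"

definition rot_y :: "real \<Rightarrow> real^2 \<Rightarrow> real" where
  "rot_y \<theta> p = cos \<theta> * p $ 2 - sin \<theta> * p $ 1"

text \<open>Twice the signed area of the triangle \<open>p q r\<close>. Its absolute value is
  invariant under rotations, reflections and shears.\<close>

definition cross :: "real^2 \<Rightarrow> real^2 \<Rightarrow> real^2 \<Rightarrow> real" where
  "cross p q r = (q $ 1 - p $ 1) * (r $ 2 - p $ 2) - (q $ 2 - p $ 2) * (r $ 1 - p $ 1)"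

text \<open>Once two distinct points \<open>p\<close> and \<open>q\<close> are fixed, a vanishing
  area means that a point equals its orthogonal projection onto their line; the coefficient is that
  of the projection.\<close>

lemma collinear_if_cross_eq_0:
  assumes "\<And>p q r. \<lbrakk>p \<in> S; q \<in> S; r \<in> S\<rbrakk> \<Longrightarrow> cross p q r = 0"
  shows "collinear S"
proof (cases "\<exists>p\<in>S. \<exists>q\<in>S. p \<noteq> q")
  case False
  then have "S \<subseteq> {SOME p. p \<in> S}" by (metis singleton_iff someI_ex subsetI)
  then show ?thesis by (metis collinear_sing collinear_subset)
next
  case True
  then obtain p q where pq: "p \<in> S" "q \<in> S" "p \<noteq> q" by blast
  let ?a = "q $ 1 - p $ 1" and ?b = "q $ 2 - p $ 2"
  have "?a \<noteq> 0 \<or> ?b \<noteq> 0" using pq(3) by (auto simp: vec_eq_iff forall_2)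
  then have D: "?a\<^sup>2 + ?b\<^sup>2 \<noteq> 0" by (simp add: sum_power2_eq_zero_iff)
  have "x = p + ((?a * (x $ 1 - p $ 1) + ?b * (x $ 2 - p $ 2)) / (?a\<^sup>2 + ?b\<^sup>2)) *\<^sub>R (q - p)"
    if "x \<in> S" for x
  proof -
    have c: "?a * (x $ 2 - p $ 2) = ?b * (x $ 1 - p $ 1)"
      using assms[OF pq(1,2) that] by (simp add: cross_def)
    have "(x $ 1 - p $ 1) * (?a\<^sup>2 + ?b\<^sup>2) = (?a * (x $ 1 - p $ 1) + ?b * (x $ 2 - p $ 2)) * ?a"
      "(x $ 2 - p $ 2) * (?a\<^sup>2 + ?b\<^sup>2) = (?a * (x $ 1 - p $ 1) + ?b * (x $ 2 - p $ 2)) * ?b"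
      using c by algebra+
    from this[THEN eq_divide_imp[OF D]]
    show ?thesis
      unfolding times_divide_eq_left[symmetric] vec_eq_iff forall_2 vector_add_component vector_scaleR_component vector_minus_component
        real_scaleR_def by linarith
  qed
  then show ?thesis unfolding collinear_alt by blast
qed

text \<open>\<open>X\<close> and \<open>Z\<close> stand for any coordinates that preserve area up to
  sign. A triangle in the strip has doubled area at most \<open>4 * D * \<delta>\<close>, below
  every nonzero value occurring in \<open>P\<close>. All triangles in the strip are thus degenerate,
  and four points there would be collinear.\<close>

lemma card_strip_le:
  assumes "finite P" "\<not> has_four_collinear P"
    and area: "\<And>p q r. \<bar>(X q - X p) * (Z r - Z p) - (Z q - Z p) * (X r - X p)\<bar> = \<bar>cross p q r\<bar>"
    and D: "\<And>p q. \<lbrakk>p \<in> P; q \<in> P\<rbrakk> \<Longrightarrow> \<bar>X q - X p\<bar> \<le> D"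
    and \<delta>: "\<And>p q r. \<lbrakk>p \<in> P; q \<in> P; r \<in> P; cross p q r \<noteq> 0\<rbrakk> \<Longrightarrow> 4 * D * \<delta> < \<bar>cross p q r\<bar>"
  shows "card {p \<in> P. \<bar>Z p\<bar> \<le> \<delta>} \<le> 3"
proof (rule ccontr)
  assume "\<not> ?thesis"
  then have "4 \<le> card {p \<in> P. \<bar>Z p\<bar> \<le> \<delta>}" by simp
  then obtain S where S: "S \<subseteq> {p \<in> P. \<bar>Z p\<bar> \<le> \<delta>}" "card S = 4"
    by (rule obtain_subset_with_card_n)
  have "cross p q r = 0" if pqr: "p \<in> S" "q \<in> S" "r \<in> S" for p q r
  proof (rule ccontr)
    assume nz: "cross p q r \<noteq> 0"
    have P: "p \<in> P" "q \<in> P" "r \<in> P" and Z: "\<bar>Z p\<bar> \<le> \<delta>" "\<bar>Z q\<bar> \<le> \<delta>" "\<bar>Z r\<bar> \<le> \<delta>"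
      using S(1) pqr by auto
    have "\<bar>Z r - Z p\<bar> \<le> 2 * \<delta>" "\<bar>Z q - Z p\<bar> \<le> 2 * \<delta>" using Z by linarith+
    then have "\<bar>(X q - X p) * (Z r - Z p)\<bar> \<le> D * (2 * \<delta>)" "\<bar>(Z q - Z p) * (X r - X p)\<bar> \<le> (2 * \<delta>) * D"
      unfolding abs_mult using D[OF P(1,2)] D[OF P(1,3)] by (intro mult_mono; linarith)+
    then have "\<bar>cross p q r\<bar> \<le> D * (2 * \<delta>) + (2 * \<delta>) * D"
      unfolding area[symmetric] by (intro order_trans[OF abs_triangle_ineq4] add_mono)
    also have "\<dots> = 4 * D * \<delta>" by simp
    finally have "\<bar>cross p q r\<bar> \<le> 4 * D * \<delta>" .
    then show False using \<delta>[OF P nz] by linarith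
  qed
  then have "collinear S" by (rule collinear_if_cross_eq_0)
  then show False
    using assms(2) S unfolding has_four_collinear_def by blast
qed

text \<open>One \<open>\<delta>\<close> serves all directions and slopes, since rotations and the
  map from \<open>(x, y)\<close> to \<open>(x, a * x + b - y)\<close> preserve area up to sign and
  \<open>D\<close> bounds the coordinate differences in every rotated frame.\<close>

lemma exists_thin_strips:
  assumes "finite P" "\<not> has_four_collinear P"
  obtains \<delta> where "0 < \<delta>" "\<And>\<theta> s. card {p \<in> P. \<bar>s - rot_x \<theta> p\<bar> \<le> \<delta>} \<le> 3"
    "\<And>\<theta> a b. card {p \<in> P. \<bar>a * rot_x \<theta> p + b - rot_y \<theta> p\<bar> \<le> \<delta>} \<le> 3"
proof -
  define D where "D = 1 + 2 * (\<Sum>p\<in>P. \<bar>p $ 1\<bar> + \<bar>p $ 2\<bar>)"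
  have "0 \<le> (\<Sum>p\<in>P. \<bar>p $ 1\<bar> + \<bar>p $ 2\<bar>)" by (intro sum_nonneg) auto
  then have D0: "0 < D" unfolding D_def by linarith
  have R: "\<bar>p $ 1\<bar> + \<bar>p $ 2\<bar> \<le> (\<Sum>p\<in>P. \<bar>p $ 1\<bar> + \<bar>p $ 2\<bar>)" if "p \<in> P" for p
    using that assms(1) by (intro member_le_sum[where f = "\<lambda>p. \<bar>p $ 1\<bar> + \<bar>p $ 2\<bar>"]) auto
  have cs: "\<bar>c * u\<bar> \<le> \<bar>u\<bar>" if "\<bar>c\<bar> \<le> 1" for c u :: real
    using that by (simp add: abs_mult mult_left_le_one_le)
  have rx: "\<bar>rot_x \<theta> p\<bar> \<le> \<bar>p $ 1\<bar> + \<bar>p $ 2\<bar>" and ry: "\<bar>rot_y \<theta> p\<bar> \<le> \<bar>p $ 1\<bar> + \<bar>p $ 2\<bar>" for \<theta> p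
    using cs[of "cos \<theta>" "p $ 1"] cs[of "sin \<theta>" "p $ 2"] cs[of "cos \<theta>" "p $ 2"] cs[of "sin \<theta>" "p $ 1"]
    unfolding rot_x_def rot_y_def by (simp_all add: abs_le_iff)
  have Dx: "\<bar>rot_x \<theta> q - rot_x \<theta> p\<bar> \<le> D" and Dy: "\<bar>rot_y \<theta> q - rot_y \<theta> p\<bar> \<le> D"
    if "p \<in> P" "q \<in> P" for \<theta> p q
    using R[OF that(1)] R[OF that(2)] rx[of \<theta> p] rx[of \<theta> q] ry[of \<theta> p] ry[of \<theta> q]
    unfolding D_def by linarith+
  \<comment> \<open>The element 1 keeps \<open>C\<close> nonempty when \<open>P\<close> has no
    nondegenerate triangle.\<close>
  define C where "C = insert 1 ((\<lambda>(p, q, r). \<bar>cross p q r\<bar>) ` (P \<times> P \<times> P) - {0})"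
  have finC: "finite C" using assms(1) by (simp add: C_def)
  have "Min C \<in> C" using finC by (intro Min_in) (auto simp: C_def)
  then have "0 < Min C" by (auto simp: C_def)
  define \<delta> where "\<delta> = Min C / (8 * D)"
  have \<delta>0: "0 < \<delta>" using \<open>0 < Min C\<close> D0 by (simp add: \<delta>_def)
  have \<delta>: "4 * D * \<delta> < \<bar>cross p q r\<bar>" if "p \<in> P" "q \<in> P" "r \<in> P" "cross p q r \<noteq> 0" for p q r
  proof -
    have "\<bar>cross p q r\<bar> \<in> C" using that by (force simp: C_def)
    then have "Min C \<le> \<bar>cross p q r\<bar>" using finC by simp
    moreover have "4 * D * \<delta> = Min C / 2" using D0 by (simp add: \<delta>_def)
    ultimately show ?thesis using \<open>0 < Min C\<close> by linarith
  qed
  have sc: "(sin \<theta>)\<^sup>2 = 1 - (cos \<theta>)\<^sup>2" for \<theta> :: real by (simp add: sin_squared_eq)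
  have "card {p \<in> P. \<bar>s - rot_x \<theta> p\<bar> \<le> \<delta>} \<le> 3" for \<theta> s
  proof (rule card_strip_le[OF assms, where X = "rot_y \<theta>" and D = D])
    fix p q r
    have "(rot_y \<theta> q - rot_y \<theta> p) * ((s - rot_x \<theta> r) - (s - rot_x \<theta> p))
        - ((s - rot_x \<theta> q) - (s - rot_x \<theta> p)) * (rot_y \<theta> r - rot_y \<theta> p) = cross p q r"
      unfolding rot_x_def rot_y_def cross_def using sc[of \<theta>] by algebra
    then show "\<bar>(rot_y \<theta> q - rot_y \<theta> p) * ((s - rot_x \<theta> r) - (s - rot_x \<theta> p))
        - ((s - rot_x \<theta> q) - (s - rot_x \<theta> p)) * (rot_y \<theta> r - rot_y \<theta> p)\<bar> = \<bar>cross p q r\<bar>"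
      by simp
  qed (use Dy \<delta> in auto)
  moreover have "card {p \<in> P. \<bar>a * rot_x \<theta> p + b - rot_y \<theta> p\<bar> \<le> \<delta>} \<le> 3" for \<theta> a b
  proof (rule card_strip_le[OF assms, where X = "rot_x \<theta>" and D = D])
    fix p q r
    let ?z = "\<lambda>p. a * rot_x \<theta> p + b - rot_y \<theta> p"
    have "(rot_x \<theta> q - rot_x \<theta> p) * (?z r - ?z p) - (?z q - ?z p) * (rot_x \<theta> r - rot_x \<theta> p) = - cross p q r"
      unfolding rot_x_def rot_y_def cross_def using sc[of \<theta>] by algebra
    then show "\<bar>(rot_x \<theta> q - rot_x \<theta> p) * (?z r - ?z p) - (?z q - ?z p) * (rot_x \<theta> r - rot_x \<theta> p)\<bar> = \<bar>cross p q r\<bar>"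
      by simp
  qed (use Dx \<delta> in auto)
  ultimately show ?thesis using that \<delta>0 by blast
qed

section \<open>Convex pieces and the contradiction from counting\<close>

lemma convex_halfplane:
  "convex {p :: real^2. \<alpha> * p $ 1 + \<beta> * p $ 2 \<le> c}" "convex {p :: real^2. \<alpha> * p $ 1 + \<beta> * p $ 2 < c}"
  using convex_halfspace_le[of "vector [\<alpha>, \<beta>] :: real^2" c] convex_halfspace_lt[of "vector [\<alpha>, \<beta>] :: real^2" c]
  by (simp_all add: inner_vec_def sum_2)

lemma convex_rotated:
  "convex {p. rot_x \<theta> p < s}" "convex {p. rot_x \<theta> p \<le> s}" "convex {p. s < rot_x \<theta> p}" "convex {p. s \<le> rot_x \<theta> p}"
  "convex {p. rot_y \<theta> p \<le> a * rot_x \<theta> p + b}" "convex {p. a * rot_x \<theta> p + b < rot_y \<theta> p}"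
proof -
  show "convex {p. rot_x \<theta> p < s}" "convex {p. rot_x \<theta> p \<le> s}"
    unfolding rot_x_def by (rule convex_halfplane)+
  have "{p. s < rot_x \<theta> p} = {p. (- cos \<theta>) * p $ 1 + (- sin \<theta>) * p $ 2 < - s}"
    "{p. s \<le> rot_x \<theta> p} = {p. (- cos \<theta>) * p $ 1 + (- sin \<theta>) * p $ 2 \<le> - s}"
    by (auto simp: rot_x_def)
  then show "convex {p. s < rot_x \<theta> p}" "convex {p. s \<le> rot_x \<theta> p}"
    by (simp_all only: convex_halfplane)
  have "{p. rot_y \<theta> p \<le> a * rot_x \<theta> p + b}
      = {p. (- sin \<theta> - a * cos \<theta>) * p $ 1 + (cos \<theta> - a * sin \<theta>) * p $ 2 \<le> b}"
    "{p. a * rot_x \<theta> p + b < rot_y \<theta> p}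
      = {p. (sin \<theta> + a * cos \<theta>) * p $ 1 + (a * sin \<theta> - cos \<theta>) * p $ 2 < - b}"
    by (auto simp: rot_x_def rot_y_def algebra_simps)
  then show "convex {p. rot_y \<theta> p \<le> a * rot_x \<theta> p + b}" "convex {p. a * rot_x \<theta> p + b < rot_y \<theta> p}"
    by (simp_all only: convex_halfplane)
qed

text \<open>\<open>Q \<times> Q\<close> splits into visible pairs, invisible pairs and the diagonal.
  Few visible pairs leave at least \<open>(1 / 5 - \<epsilon>) * (card Q)\<^sup>2 - card Q\<close>
  invisible ordered pairs, and every triple accounts for at most two of them.\<close>

lemma card_triples_ge:
  assumes P: "finite P" "Q = P \<inter> C" "convex C"
    and few: "(\<Sum>v\<in>Q. card (nbhd Q (visible P) v)) \<le> (1 - 1 / 5 + \<epsilon>) * (card Q)\<^sup>2"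
  shows "(1 / 10 - \<epsilon> / 2) * (card Q)\<^sup>2 - card Q / 2 \<le> card (triples Q)"
proof -
  let ?I = "{(p, q). p \<in> Q \<and> q \<in> Q \<and> p \<noteq> q \<and> \<not> visible P p q}"
  let ?V = "Sigma Q (nbhd Q (visible P))"
  have finQ: "finite Q" using P by simp
  have finV: "finite ?V" and finI: "finite ?I"
    using finQ by (auto simp: nbhd_def intro: finite_subset[of _ "Q \<times> Q"])
  have "Q \<times> Q = (?V \<union> ?I) \<union> (\<lambda>p. (p, p)) ` Q"
    by (auto simp: nbhd_def)
  then have "(card Q)\<^sup>2 = card ((?V \<union> ?I) \<union> (\<lambda>p. (p, p)) ` Q)"
    by (metis card_cartesian_product power2_eq_square)
  also have "\<dots> \<le> card ?V + card ?I + card Q"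
    using card_Un_le[of "?V \<union> ?I" "(\<lambda>p. (p, p)) ` Q"] card_Un_le[of ?V ?I] card_image_le[OF finQ, of "\<lambda>p. (p, p)"]
    by linarith
  also have "card ?V = (\<Sum>v\<in>Q. card (nbhd Q (visible P) v))"
    using finQ by (intro card_SigmaI) (auto simp: nbhd_def)
  also have "card ?I \<le> 2 * card (triples Q)"
    using P by (rule card_not_visible_le)
  finally have "real ((card Q)\<^sup>2) \<le> real ((\<Sum>v\<in>Q. card (nbhd Q (visible P) v)) + 2 * card (triples Q) + card Q)"
    by (simp only: of_nat_le_iff)
  then show ?thesis
    using few by (simp add: algebra_simps)
qed

text \<open>The leading coefficients are 3 on the left and \<open>32 * 99 / 1000 = 3.168\<close> on
  the right; the bound on \<open>m\<close> lets the gap absorb the lower order terms.\<close>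

lemma grid_numbers:
  fixes m :: real
  assumes "1000 \<le> m"
  shows "3 * (m + 10)\<^sup>2 < 4 * (99 / 1000 * (m - 10)\<^sup>2 - (m + 10) / 2)
    + 7 * (99 / 1000 * (2 * (m - 10))\<^sup>2 - (m + 10))"
proof -
  have "1000 * m \<le> m\<^sup>2"
    using assms unfolding power2_eq_square by (intro mult_right_mono) auto
  moreover have sq: "(m + 10)\<^sup>2 = m\<^sup>2 + 20 * m + 100" "(m - 10)\<^sup>2 = m\<^sup>2 - 20 * m + 100"
      "(2 * (m - 10))\<^sup>2 = 4 * m\<^sup>2 - 80 * m + 400"
    by (simp_all add: power2_eq_square algebra_simps)
  ultimately show ?thesis
    unfolding sq using assms by (simp add: field_simps)
qed

lemma exists_dense_convex_part:
  assumes "finite P" "\<not> has_four_collinear P" and big: "6000 \<le> card P" "6 * (M + 10) \<le> card P"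
  shows "\<exists>C. convex C \<and> M \<le> card (P \<inter> C) \<and>
    (1 - 1 / 5 + 1 / 500) * (card (P \<inter> C))\<^sup>2 < (\<Sum>v\<in>P \<inter> C. card (nbhd (P \<inter> C) (visible P) v))"
proof (rule ccontr)
  assume neg: "\<not> ?thesis"
  \<comment> \<open>The constant \<open>99 / 1000\<close> is \<open>1 / 10 - (1 / 500) / 2\<close>.
    The numbers \<open>r\<close> and \<open>R\<close> enclose the size of the piece, so that pieces
    of slightly different sizes get the same bound.\<close>
  have low: "99 / 1000 * r\<^sup>2 - R / 2 \<le> card (triples (P \<inter> C))"
    if "convex C" "M \<le> card (P \<inter> C)" "0 \<le> r" "r \<le> card (P \<inter> C)" "card (P \<inter> C) \<le> R" for C and r R :: real
  proof -
    have "(\<Sum>v\<in>P \<inter> C. card (nbhd (P \<inter> C) (visible P) v)) \<le> (1 - 1 / 5 + 1 / 500) * (card (P \<inter> C))\<^sup>2"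
      using neg that(1,2) not_le by blast
    then have "(1 / 10 - (1 / 500) / 2) * (card (P \<inter> C))\<^sup>2 - card (P \<inter> C) / 2 \<le> card (triples (P \<inter> C))"
      by (rule card_triples_ge[OF assms(1) refl that(1)])
    moreover have "r\<^sup>2 \<le> (real (card (P \<inter> C)))\<^sup>2"
      using that(3,4) by (intro power_mono)
    ultimately show ?thesis using that(5) by simp
  qed
  obtain \<delta> where \<delta>: "0 < \<delta>" "\<And>\<theta> s. card {p \<in> P. \<bar>s - rot_x \<theta> p\<bar> \<le> \<delta>} \<le> 3"
    "\<And>\<theta> a b. card {p \<in> P. \<bar>a * rot_x \<theta> p + b - rot_y \<theta> p\<bar> \<le> \<delta>} \<le> 3"
    using exists_thin_strips[OF assms(1,2)] by blast
  define \<eta> where "\<eta> = \<delta> / card P"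
  interpret sweep P rot_x rot_y \<delta> \<eta>
  proof
    show "continuous_on UNIV (\<lambda>\<theta>. rot_x \<theta> p)" "continuous_on UNIV (\<lambda>\<theta>. rot_y \<theta> p)" for p
      unfolding rot_x_def rot_y_def by (intro continuous_intros)+
  qed (use assms \<delta> in \<open>auto simp: \<eta>_def rot_x_def rot_y_def\<close>)
  obtain \<theta> s t a b where st: "s < t" and parts:
    "\<And>S. S \<in> {{p \<in> P. rot_x \<theta> p < s}, {p \<in> P. s \<le> rot_x \<theta> p \<and> rot_x \<theta> p \<le> t}, {p \<in> P. t < rot_x \<theta> p}} \<Longrightarrow>
      \<bar>card (S \<inter> below \<theta> a b) - card P / 6\<bar> \<le> 10 \<and> \<bar>card (S - below \<theta> a b) - card P / 6\<bar> \<le> 10"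
    by (rule exists_six_parts) blast
  define m where "m = card P / 6"
  have m: "1000 \<le> m" "M + 10 \<le> m" using big by (simp_all add: m_def)
  define X1 X2 X3 Y1 Y2 where "X1 = {p. rot_x \<theta> p < s}" and "X2 = {p. s \<le> rot_x \<theta> p} \<inter> {p. rot_x \<theta> p \<le> t}"
    and "X3 = {p. t < rot_x \<theta> p}" and "Y1 = {p. rot_y \<theta> p \<le> a * rot_x \<theta> p + b}"
    and "Y2 = {p. a * rot_x \<theta> p + b < rot_y \<theta> p}"
  note X_defs = X1_def X2_def X3_def Y1_def Y2_def
  have X12: "X1 \<union> X2 = {p. rot_x \<theta> p \<le> t}" and X23: "X2 \<union> X3 = {p. s \<le> rot_x \<theta> p}" and Y12: "Y1 \<union> Y2 = UNIV"
    using st by (auto simp: X_defs)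
  have conv: "convex X1" "convex X2" "convex X3" "convex Y1" "convex Y2" "convex (X1 \<union> X2)" "convex (X2 \<union> X3)"
    unfolding X12 X23 unfolding X_defs by (intro convex_Int convex_rotated)+
  \<comment> \<open>Indices 0, 1, 2 are the cells on or below the transversal, 3, 4, 5 those above
    it, each from left to right. The empty value for all other indices makes the whole family
    disjoint.\<close>
  define A where "A i = (if i = 0 then P \<inter> (X1 \<inter> Y1) else if i = 1 then P \<inter> (X2 \<inter> Y1) else if i = 2 then P \<inter> (X3 \<inter> Y1)
    else if i = 3 then P \<inter> (X1 \<inter> Y2) else if i = 4 then P \<inter> (X2 \<inter> Y2) else if i = 5 then P \<inter> (X3 \<inter> Y2) else {})" for i :: nat
  have A: "A 0 = P \<inter> (X1 \<inter> Y1)" "A 1 = P \<inter> (X2 \<inter> Y1)" "A 2 = P \<inter> (X3 \<inter> Y1)"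
    "A 3 = P \<inter> (X1 \<inter> Y2)" "A 4 = P \<inter> (X2 \<inter> Y2)" "A 5 = P \<inter> (X3 \<inter> Y2)"
    by (simp_all add: A_def)
  have finA: "finite (A i)" for i using assms(1) by (simp add: A_def)
  have sub: "A i \<subseteq> P" for i by (simp add: A_def)
  have disjX: "X1 \<inter> X2 = {}" "X1 \<inter> X3 = {}" "X2 \<inter> X3 = {}" "Y1 \<inter> Y2 = {}"
    using st by (auto simp: X_defs)
  then have disj: "A i \<inter> A j = {}" if "i \<noteq> j" for i j
    using that unfolding A_def by (auto split: if_splits)
  have "P \<inter> X1 = {p \<in> P. rot_x \<theta> p < s}" "P \<inter> X2 = {p \<in> P. s \<le> rot_x \<theta> p \<and> rot_x \<theta> p \<le> t}"
    "P \<inter> X3 = {p \<in> P. t < rot_x \<theta> p}"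
    by (auto simp: X_defs)
  moreover have "S \<inter> below \<theta> a b = S \<inter> Y1" "S - below \<theta> a b = S \<inter> Y2" for S
    by (auto simp: below_def X_defs)
  ultimately have cell: "\<bar>card (P \<inter> X \<inter> Y) - m\<bar> \<le> 10" if "X \<in> {X1, X2, X3}" "Y \<in> {Y1, Y2}" for X Y
    using parts[of "P \<inter> X"] that by (auto simp: m_def)
  have c: "\<bar>card (A i) - m\<bar> \<le> 10" if "i < 6" for i
  proof -
    have "i \<in> {0, 1, 2, 3, 4, 5}" using that by auto
    then show ?thesis
      using cell by (elim insertE emptyE) (simp_all add: A Int_assoc del: One_nat_def)
  qed
  have c: "m - 10 \<le> card (A i)" "card (A i) \<le> m + 10" if "i < 6" for i
    using c[OF that] by linarith+
  let ?f = "\<lambda>X. card (triples X)"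
  let ?r = "m - 10"
  have one: "99 / 1000 * ?r\<^sup>2 - (m + 10) / 2 \<le> ?f (A i)" if "i < 6" "A i = P \<inter> C" "convex C" for i C
  proof -
    have "m - 10 \<le> card (A i)" "card (A i) \<le> m + 10" using c[OF that(1)] by linarith+
    then show ?thesis
      using low[OF that(3), of ?r "m + 10"] m unfolding that(2) by linarith
  qed
  have two: "99 / 1000 * (2 * ?r)\<^sup>2 - (m + 10) \<le> ?f (A i \<union> A j)"
    if "i < 6" "j < 6" "i \<noteq> j" "A i \<union> A j = P \<inter> C" "convex C" for i j C
  proof -
    have "card (A i \<union> A j) = card (A i) + card (A j)"
      using disj[OF that(3)] finA by (intro card_Un_disjoint)
    then have "real (card (A i \<union> A j)) = real (card (A i)) + real (card (A j))" by simp
    then have "2 * ?r \<le> card (A i \<union> A j)" "card (A i \<union> A j) \<le> 2 * (m + 10)"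
      using c[OF that(1)] c[OF that(2)] unfolding distrib_left right_diff_distrib by linarith+
    then have b: "2 * ?r \<le> card (P \<inter> C)" "card (P \<inter> C) \<le> 2 * (m + 10)"
      unfolding that(4) .
    have "real M \<le> ?r" "0 \<le> ?r" using m by simp_all
    then have "M \<le> card (P \<inter> C)" "0 \<le> 2 * ?r" using b(1) by simp_all
    then have "99 / 1000 * (2 * ?r)\<^sup>2 - 2 * (m + 10) / 2 \<le> ?f (P \<inter> C)"
      using b by (intro low[OF that(5)])
    moreover have "2 * (m + 10) / 2 = m + 10" by simp
    ultimately show ?thesis unfolding that(4) by metis
  qed
  have corners: "99 / 1000 * ?r\<^sup>2 - (m + 10) / 2 \<le> ?f (A 0)" "99 / 1000 * ?r\<^sup>2 - (m + 10) / 2 \<le> ?f (A 2)"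
    "99 / 1000 * ?r\<^sup>2 - (m + 10) / 2 \<le> ?f (A 3)" "99 / 1000 * ?r\<^sup>2 - (m + 10) / 2 \<le> ?f (A 5)"
    by (rule one[OF _ A(1)] one[OF _ A(3)] one[OF _ A(4)] one[OF _ A(6)]; simp add: convex_Int conv)+
  \<comment> \<open>Neighbours in a row fill a half-plane cut by the transversal, and the two cells
    of a column fill a whole strip. This exhibits all seven unions as convex pieces.\<close>
  have u: "A 0 \<union> A 1 = P \<inter> ((X1 \<union> X2) \<inter> Y1)" "A 1 \<union> A 2 = P \<inter> ((X2 \<union> X3) \<inter> Y1)"
    "A 3 \<union> A 4 = P \<inter> ((X1 \<union> X2) \<inter> Y2)" "A 4 \<union> A 5 = P \<inter> ((X2 \<union> X3) \<inter> Y2)"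
    "A 0 \<union> A 3 = P \<inter> X1" "A 1 \<union> A 4 = P \<inter> X2" "A 2 \<union> A 5 = P \<inter> X3"
    unfolding A using Y12 by blast+
  let ?g = "99 / 1000 * (2 * ?r)\<^sup>2 - (m + 10)"
  have unions: "?g \<le> ?f (A 0 \<union> A 1)" "?g \<le> ?f (A 1 \<union> A 2)" "?g \<le> ?f (A 3 \<union> A 4)" "?g \<le> ?f (A 4 \<union> A 5)"
    "?g \<le> ?f (A 0 \<union> A 3)" "?g \<le> ?f (A 1 \<union> A 4)" "?g \<le> ?f (A 2 \<union> A 5)"
    by (rule two[OF _ _ _ u(1)] two[OF _ _ _ u(2)] two[OF _ _ _ u(3)] two[OF _ _ _ u(4)]
        two[OF _ _ _ u(5)] two[OF _ _ _ u(6)] two[OF _ _ _ u(7)]; simp add: convex_Int conv)+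
  have tri: "{T \<in> triples P. T \<subseteq> X} = triples X" if "X \<subseteq> P" for X
    using that by (auto simp: triples_def)
  have three: "card T = 3" if "T \<in> triples P" for T
    using that by (simp add: triples_def)
  have finT: "finite (triples P)" using assms(1) by (simp add: triples_def)
  have "?f (A 0) + ?f (A 2) + ?f (A 3) + ?f (A 5)
    + ?f (A 0 \<union> A 1) + ?f (A 1 \<union> A 2) + ?f (A 3 \<union> A 4) + ?f (A 4 \<union> A 5)
    + ?f (A 0 \<union> A 3) + ?f (A 1 \<union> A 4) + ?f (A 2 \<union> A 5) \<le> (\<Sum>i<6. card (A i) choose 2)"
    using grid_count[of A "triples P", OF finA finT disj three triples_Int[OF assms(2)]]
    by (simp add: tri sub)
  then have "real (?f (A 0)) + ?f (A 2) + ?f (A 3) + ?f (A 5)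
    + ?f (A 0 \<union> A 1) + ?f (A 1 \<union> A 2) + ?f (A 3 \<union> A 4) + ?f (A 4 \<union> A 5)
    + ?f (A 0 \<union> A 3) + ?f (A 1 \<union> A 4) + ?f (A 2 \<union> A 5) \<le> real (\<Sum>i<6. card (A i) choose 2)"
    unfolding of_nat_add[symmetric] of_nat_le_iff .
  moreover have "real (\<Sum>i<6. card (A i) choose 2) \<le> (\<Sum>i<(6::nat). (m + 10)\<^sup>2 / 2)"
    unfolding of_nat_sum
  proof (rule sum_mono)
    fix i :: nat assume "i \<in> {..<6}"
    then have i: "real (card (A i)) \<le> m + 10" using c[of i] by auto
    have "2 * (card (A i) choose 2) \<le> card (A i) * card (A i)"
      unfolding choose_two by (rule order_trans[OF times_div_less_eq_dividend]) simp
    then have "2 * real (card (A i) choose 2) \<le> real (card (A i)) * card (A i)"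
      by (metis of_nat_le_iff of_nat_mult of_nat_numeral)
    also have "\<dots> \<le> (m + 10) * (m + 10)" using i by (intro mult_mono) auto
    finally show "real (card (A i) choose 2) \<le> (m + 10)\<^sup>2 / 2"
      by (simp add: power2_eq_square)
  qed
  moreover have "(\<Sum>i<(6::nat). (m + 10)\<^sup>2 / 2) = 3 * (m + 10)\<^sup>2" by simp
  \<comment> \<open>Naming the two lower bounds hides their squares and leaves a linear
    comparison.\<close>
  moreover define p q where "p = 99 / 1000 * ?r\<^sup>2 - (m + 10) / 2" and "q = ?g"
  note corners[folded p_def] unions[folded q_def] grid_numbers[OF m(1), folded p_def q_def]
  ultimately show False by linarith
qed

theorem theorem1p3:
  fixes H :: "'a pair_pre_digraph"
  assumes "pair_graph H"
    and "chromatic_number H = 6"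
    and "\<exists>e. color_critical H e"
  shows "\<exists>N::nat. \<forall>P :: (real^2) set. finite P \<longrightarrow> card P \<ge> N \<longrightarrow>
           has_four_collinear P \<or> contains_copy (visibility_graph P) H"
proof -
  obtain c where c: "proper_coloring H 6 c"
    using chromatic_number_coloring[OF assms(1)] assms(2) by auto
  have "(0::real) < 1 / 500" "(1::nat) \<le> 5" by auto
  \<comment> \<open>Six classes correspond to \<open>r = 5\<close>, with density threshold
    \<open>1 - 1 / 5\<close>. Classes of size \<open>card (pverts H)\<close> have room for any
    colour class of \<open>H\<close>.\<close>
  then obtain M where M: "\<forall>(V :: (real^2) set) E. finite V \<longrightarrow> M \<le> card V \<longrightarrow> (\<forall>u v. E u v \<longrightarrow> E v u) \<longrightarrow> (\<forall>v. \<not> E v v) \<longrightarrow>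
    (\<Sum>v\<in>V. card (nbhd V E v)) \<ge> (1 - 1 / real 5 + 1 / 500) * (card V)\<^sup>2 \<longrightarrow> has_blowup (Suc 5) (card (pverts H)) V E"
    using erdos_stone[of "1 / 500" 5 "card (pverts H)"] by blast
  show ?thesis
  proof (intro exI[of _ "6000 + 6 * (M + 10)"] allI impI)
    fix P :: "(real^2) set" assume P: "finite P" "6000 + 6 * (M + 10) \<le> card P"
    have "contains_copy (visibility_graph P) H" if ncol: "\<not> has_four_collinear P"
    proof -
      obtain C where C: "M \<le> card (P \<inter> C)"
        "(1 - 1 / 5 + 1 / 500) * (card (P \<inter> C))\<^sup>2 < (\<Sum>v\<in>P \<inter> C. card (nbhd (P \<inter> C) (visible P) v))"
        using exists_dense_convex_part[OF P(1) ncol, of M] P(2) by auto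
      \<comment> \<open>The relation is visibility in all of \<open>P\<close>, so the subgraph found
        inside the convex piece lies in the visibility graph of \<open>P\<close>.\<close>
      have "has_blowup (Suc 5) (card (pverts H)) (P \<inter> C) (visible P)"
        using M[rule_format, of "P \<inter> C" "visible P"] P(1) C
        by (auto simp: visible_def open_segment_commute)
      then have "has_blowup 6 (card (pverts H)) (pverts (visibility_graph P))
          (\<lambda>u v. (u, v) \<in> parcs (visibility_graph P))"
        using has_blowup_mono[of _ _ "P \<inter> C" _ P] by (simp add: visibility_graph_def)
      then show ?thesis
        by (rule contains_copy_of_blowup[OF assms(1) pair_graph_visibility_graph[OF P(1)] c])
    qed
    then show "has_four_collinear P \<or> contains_copy (visibility_graph P) H" by blast
  qed
qed

end
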